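(* Let $A$ be a Banach lattice algebra with identity $e$, let $A_\mathbb C$ be its complexification and let $(A_\mathbb C)_e=\{w\in A_\mathbb C: |w|\le\lambda e\text{ for some }\lambda\ge0\}$. Then $(A_\mathbb C)_e=(A_e)_\mathbb C=A_e+iA_e$, and: (i) for every $z\in(A_\mathbb C)_e$ one has $\|z\|_\mathbb C=\|z\|_e=r(z)$, where $\|z\|_e=\inf\{\lambda>0:|z|\le\lambda e\}$ and $r(z)$ is the spectral radius of $z$ in $A_\mathbb C$; and $((A_\mathbb C)_e,\|\cdot\|_\mathbb C)$ is isometrically lattice and algebra isomorphic to $C(K,\mathbb C)$ for some compact Hausdorff $K$; in particular, on $A_e$ the norms $\|\cdot\|$ and $\|\cdot\|_e$ coincide; (ii) $(A_\mathbb C)_e$ is a projection band in $A_\mathbb C$, i.e. $A_\mathbb C=(A_\mathbb C)_e\oplus (A_\mathbb C)_e^{d}$ where $(A_\mathbb C)_e^d=\{z: |w|\wedge|z|=0\ \forall w\in(A_\mathbb C)_e\}$; (iii) $(A_\mathbb C)_e$ is an inverse closed subalgebra of $A_\mathbb C$.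
   Context: A Banach lattice algebra is a real Banach lattice $A$ with an associative bilinear product making it a Banach algebra such that $xy\ge0$ whenever $x,y\ge0$; identity $e$ means a multiplicative identity with $\|e\|=1$. $A_e=\{x\in A:|x|\le\lambda e \text{ for some }\lambda\ge0\}$. The complexification $A_\mathbb C=\{x+iy: x,y\in A\}$ has modulus $|x+iy|=\sup_{0\le\theta\le2\pi}(x\cos\theta+y\sin\theta)$ (supremum in $A$), norm $\|z\|_\mathbb C=\||z|\|$, and product $(x_1+ix_2)(y_1+iy_2)=(x_1y_1-x_2y_2)+i(x_1y_2+x_2y_1)$; it is a complex Banach algebra with identity $e$. $C(K,\mathbb C)$ carries pointwise operations, pointwise modulus and sup norm. Inverse closed means: if $b$ in the subalgebra is invertible in $A_\mathbb C$ then $b^{-1}$ lies in the subalgebra. *)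

theory Defs
  imports "HOL-Analysis.Analysis" "HOL-Library.Lattice_Algebras"
begin

text \<open>The real Banach lattice algebra is a type 'a of class
  real_normed_algebra_1 + banach + lattice_ab_group_add (with the remaining
  compatibility axioms stated as assumptions of the theorem).  The identity e is 1.
  Elements of the complexification A_C are pairs (x,y) standing for x + i y.\<close>

definition lat_abs :: "'a::lattice_ab_group_add \<Rightarrow> 'a" where
  "lat_abs x = sup x (- x)"

definition Ae :: "'a::{lattice_ab_group_add, real_normed_algebra_1} set" where
  "Ae = {x. \<exists>l::real. l \<ge> 0 \<and> lat_abs x \<le> l *\<^sub>R 1}"

definition cabs :: "'a::{lattice_ab_group_add, real_normed_vector} \<times> 'a \<Rightarrow> 'a" where
  "cabs z = (THE m. (\<forall>t\<in>{0..2*pi}. cos t *\<^sub>R fst z + sin t *\<^sub>R snd z \<le> m) \<and>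
       (\<forall>u. (\<forall>t\<in>{0..2*pi}. cos t *\<^sub>R fst z + sin t *\<^sub>R snd z \<le> u) \<longrightarrow> m \<le> u))"

definition cnorm :: "'a::{lattice_ab_group_add, real_normed_vector} \<times> 'a \<Rightarrow> real" where
  "cnorm z = norm (cabs z)"

definition cadd :: "'a::ab_group_add \<times> 'a \<Rightarrow> 'a \<times> 'a \<Rightarrow> 'a \<times> 'a" where
  "cadd z w = (fst z + fst w, snd z + snd w)"

definition cminus :: "'a::ab_group_add \<times> 'a \<Rightarrow> 'a \<times> 'a \<Rightarrow> 'a \<times> 'a" where
  "cminus z w = (fst z - fst w, snd z - snd w)"

definition cscale :: "complex \<Rightarrow> 'a::real_vector \<times> 'a \<Rightarrow> 'a \<times> 'a" where
  "cscale c z = (Re c *\<^sub>R fst z - Im c *\<^sub>R snd z, Re c *\<^sub>R snd z + Im c *\<^sub>R fst z)"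

definition cmult :: "'a::ring \<times> 'a \<Rightarrow> 'a \<times> 'a \<Rightarrow> 'a \<times> 'a" where
  "cmult z w = (fst z * fst w - snd z * snd w, fst z * snd w + snd z * fst w)"

definition cone :: "'a::ring_1 \<times> 'a" where
  "cone = (1, 0)"

definition cinvertible :: "'a::ring_1 \<times> 'a \<Rightarrow> bool" where
  "cinvertible z \<longleftrightarrow> (\<exists>w. cmult z w = cone \<and> cmult w z = cone)"

definition cspectrum :: "'a::real_algebra_1 \<times> 'a \<Rightarrow> complex set" where
  "cspectrum z = {c. \<not> cinvertible (cminus z (cscale c cone))}"

definition cspectral_radius :: "'a::real_algebra_1 \<times> 'a \<Rightarrow> real" where
  "cspectral_radius z = Sup (cmod ` cspectrum z)"

definition ACe :: "('a::{lattice_ab_group_add, real_normed_algebra_1} \<times> 'a) set" where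
  "ACe = {z. \<exists>l::real. l \<ge> 0 \<and> cabs z \<le> l *\<^sub>R 1}"

definition enorm :: "'a::{lattice_ab_group_add, real_normed_algebra_1} \<times> 'a \<Rightarrow> real" where
  "enorm z = Inf {l::real. l > 0 \<and> cabs z \<le> l *\<^sub>R 1}"

definition cdisj :: "('a::{lattice_ab_group_add, real_normed_vector} \<times> 'a) set \<Rightarrow> ('a \<times> 'a) set" where
  "cdisj S = {z. \<forall>w\<in>S. inf (cabs w) (cabs z) = 0}"

end

(* The band decomposition rests on one estimate: an element x of A_e satisfies |x| <= ||x|| 1.  Indeed
   A_e is an f-algebra, so for x >= 0 the positive part u of x - 1 satisfies (x - 1) u = u^2 >= 0,
   that is u <= x u, which forces u = 0 when ||x|| < 1.  Hence A_e is closed, its norm is the order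
   unit norm, and the truncations of any a >= 0 by n 1 are bounded by ||a|| 1, so that A_e is a
   projection band.  If b lies in A_e + i A_e and w is its inverse, the component v of w in the
   complementary band satisfies b v = 0, whence v = w b v = 0.  Maximal order ideals avoiding a given
   element are prime and yield enough multiplicative functionals on A_e to identify it, via
   Stone-Weierstrass, with C(K); inverse closedness then identifies the spectrum of z in the
   complexification with the range of its transform. *)

theory Submission
  imports Defs
begin

section \<open>Lattice-ordered groups\<close>

text \<open>\<open>Ae\<close> is controlled by one inequality: if |x| <= l 1, then |x y| and |y x|
  are at most l |y| for every y of the algebra. It makes products of disjoint elements of
  \<open>Ae\<close> vanish, which is all the f-algebra structure that the norm estimate needs, and
  it keeps the complementary band stable under multiplication by \<open>Ae\<close>. Two facts must
  be earned beforehand. Positivity of 1 is not among the hypotheses; it is forced by norm 1 = 1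
  through the growth of the powers of |1|. And \<open>cabs\<close> is a supremum over infinitely
  many angles in a lattice that need not be order complete, so its existence is drawn from norm
  completeness. Inverse closedness matters for the spectrum because invertibility is tested in the
  whole complexification: an inverse lying outside \<open>ACe\<close> could remove a value of the
  transform from the spectrum.\<close>

lemma lat_abs_ge: "x \<le> lat_abs x" "- x \<le> lat_abs x"
  for x :: "'a::lattice_ab_group_add"
  by (simp_all add: lat_abs_def)

lemma lat_abs_le_iff: "lat_abs x \<le> a \<longleftrightarrow> x \<le> a \<and> - x \<le> a"
  for x :: "'a::lattice_ab_group_add"
  by (simp add: lat_abs_def)

lemma lat_abs_nonneg: "0 \<le> lat_abs x" for x :: "'a::lattice_ab_group_add"
  using add_mono[OF lat_abs_ge(1)[of x] lat_abs_ge(2)[of x]] by simp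

lemma lat_abs_of_nonneg: "0 \<le> x \<Longrightarrow> lat_abs x = x" for x :: "'a::lattice_ab_group_add"
  unfolding lat_abs_def by (metis minus_le_self_iff sup_absorb1)

lemma lat_abs_idem: "lat_abs (lat_abs x) = lat_abs x" for x :: "'a::lattice_ab_group_add"
  by (simp add: lat_abs_of_nonneg lat_abs_nonneg)

lemma lat_abs_minus: "lat_abs (- x) = lat_abs x" for x :: "'a::lattice_ab_group_add"
  by (simp add: lat_abs_def sup_commute)

lemma lat_abs_eq_0_iff: "lat_abs x = 0 \<longleftrightarrow> x = 0" for x :: "'a::lattice_ab_group_add"
  by (simp add: lat_abs_def)

lemma lat_abs_triangle: "lat_abs (x + y) \<le> lat_abs x + lat_abs y"
  for x :: "'a::lattice_ab_group_add"
  unfolding lat_abs_le_iff using add_mono[OF lat_abs_ge(1)[of x] lat_abs_ge(1)[of y]]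
    add_mono[OF lat_abs_ge(2)[of x] lat_abs_ge(2)[of y]] by simp

lemma pprt_diff_nprt: "x = pprt x - pprt (- x)" for x :: "'a::lattice_ab_group_add"
  using prts[of x] by (simp add: pprt_neg)

text \<open>Since \<open>pprt x = x + pprt (- x)\<close>, the infimum is \<open>inf x 0\<close>
  translated by \<open>pprt (- x)\<close>, and these two cancel.\<close>

lemma pprt_inf_pprt_minus: "inf (pprt x) (pprt (- x)) = 0" for x :: "'a::lattice_ab_group_add"
proof -
  have "inf (pprt x) (pprt (- x)) = inf (x + pprt (- x)) (0 + pprt (- x))"
    using pprt_diff_nprt[of x] by (metis add_0 diff_add_cancel)
  also have "\<dots> = 0"
    unfolding add_inf_distrib_right[symmetric] by (simp add: nprt_def[symmetric] pprt_neg)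
  finally show ?thesis .
qed

text \<open>The two parts are disjoint, and for disjoint elements the sum is the supremum, which
  lies below |x|.\<close>

lemma lat_abs_eq_pprt: "lat_abs x = pprt x + pprt (- x)" for x :: "'a::lattice_ab_group_add"
proof (rule antisym)
  show "lat_abs x \<le> pprt x + pprt (- x)"
    unfolding lat_abs_le_iff by (simp add: pprt_def add_increasing2 add_increasing)
  have "pprt x + pprt (- x) = sup (pprt x) (pprt (- x))"
    using add_eq_inf_sup[of "pprt x" "pprt (- x)"] by (simp add: pprt_inf_pprt_minus)
  also have "\<dots> \<le> lat_abs x"
    using lat_abs_nonneg lat_abs_ge by (auto simp: pprt_def)
  finally show "pprt x + pprt (- x) \<le> lat_abs x" .
qed

lemma pprt_le_lat_abs: "pprt x \<le> lat_abs x" for x :: "'a::lattice_ab_group_add"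
  by (simp add: lat_abs_eq_pprt)

lemma pprt_subadditive: "pprt (x + y) \<le> pprt x + pprt y" for x :: "'a::lattice_ab_group_add"
proof -
  have "x + y \<le> pprt x + pprt y"
    by (intro add_mono) (simp_all add: pprt_def)
  then show ?thesis
    unfolding pprt_def[of "x + y"] by (simp add: add_nonneg_nonneg)
qed

text \<open>By distributivity the right-hand side is the infimum of the four sums a + b, a + c, c +
  b and c + c, each of which dominates the left-hand side.\<close>

lemma inf_add_le: "0 \<le> a \<Longrightarrow> 0 \<le> b \<Longrightarrow> 0 \<le> c \<Longrightarrow> inf (a + b) c \<le> inf a c + inf b c"
  for a :: "'a::lattice_ab_group_add"
proof -
  assume nn: "0 \<le> a" "0 \<le> b" "0 \<le> c"
  have "inf a c + inf b c = inf (inf (a + b) (a + c)) (inf (c + b) (c + c))"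
    by (simp add: add_inf_distrib_right add_inf_distrib_left inf_aci)
  moreover have "inf (a + b) c \<le> a + c" "inf (a + b) c \<le> c + b" "inf (a + b) c \<le> c + c"
    by (rule le_infI2, use nn in simp)+
  ultimately show ?thesis
    by simp
qed

lemma disjoint_add:
  "0 \<le> a \<Longrightarrow> 0 \<le> b \<Longrightarrow> 0 \<le> c \<Longrightarrow> inf a c = 0 \<Longrightarrow> inf b c = 0 \<Longrightarrow> inf (a + b) c = 0"
  for a :: "'a::lattice_ab_group_add"
  using inf_add_le[of a b c] by (simp add: order.antisym)

lemma disjoint_mono:
  "0 \<le> a \<Longrightarrow> a \<le> b \<Longrightarrow> 0 \<le> c \<Longrightarrow> c \<le> d \<Longrightarrow> inf b d = 0 \<Longrightarrow> inf a c = 0"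
  for a :: "'a::lattice_ab_group_add"
  by (metis inf.boundedI inf_mono order.antisym)

section \<open>Banach lattice algebras\<close>

locale banach_lattice_algebra =
  fixes type :: "'a::{real_normed_algebra_1, banach, lattice_ab_group_add} itself"
  assumes scaleR_mono: "\<And>(x::'a) y (c::real). x \<le> y \<Longrightarrow> 0 \<le> c \<Longrightarrow> c *\<^sub>R x \<le> c *\<^sub>R y"
    and lattice_norm: "\<And>(x::'a) y. lat_abs x \<le> lat_abs y \<Longrightarrow> norm x \<le> norm y"
    and mult_nonneg: "\<And>(x::'a) y. 0 \<le> x \<Longrightarrow> 0 \<le> y \<Longrightarrow> 0 \<le> x * y"
begin

section \<open>Compatibility of the order with scalars, products and the norm\<close>

lemma scaleR_nonneg: "0 \<le> c \<Longrightarrow> 0 \<le> x \<Longrightarrow> 0 \<le> c *\<^sub>R x" for x :: 'a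
  using scaleR_mono[of 0 x c] by simp

lemma scaleR_mono_left: "c \<le> d \<Longrightarrow> 0 \<le> x \<Longrightarrow> c *\<^sub>R x \<le> d *\<^sub>R x" for x :: 'a
  using scaleR_nonneg[of "d - c" x] by (simp add: scaleR_left_diff_distrib)

lemma mult_mono_nonneg_left: "0 \<le> c \<Longrightarrow> x \<le> y \<Longrightarrow> c * x \<le> c * y" for x :: 'a
  using mult_nonneg[of c "y - x"] by (simp add: right_diff_distrib)

lemma mult_mono_nonneg_right: "0 \<le> c \<Longrightarrow> x \<le> y \<Longrightarrow> x * c \<le> y * c" for x :: 'a
  using mult_nonneg[of "y - x" c] by (simp add: left_diff_distrib)

lemma pprt_scaleR: "0 < c \<Longrightarrow> pprt (c *\<^sub>R x) = c *\<^sub>R pprt x" for x :: 'a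
proof (rule antisym)
  assume c: "0 < c"
  show "pprt (c *\<^sub>R x) \<le> c *\<^sub>R pprt x"
    using c scaleR_mono[of x "pprt x" c] scaleR_nonneg[of c "pprt x"] by (simp add: pprt_def)
  have "x \<le> (1/c) *\<^sub>R pprt (c *\<^sub>R x)"
    using scaleR_mono[of "c *\<^sub>R x" "pprt (c *\<^sub>R x)" "1/c"] c by (simp add: pprt_def)
  moreover have "0 \<le> (1/c) *\<^sub>R pprt (c *\<^sub>R x)"
    using c by (intro scaleR_nonneg) auto
  ultimately have "pprt x \<le> (1/c) *\<^sub>R pprt (c *\<^sub>R x)"
    by (simp add: pprt_def)
  from scaleR_mono[OF this, of c] show "c *\<^sub>R pprt x \<le> pprt (c *\<^sub>R x)"
    using c by simp
qed

lemma lat_abs_scaleR_le: "lat_abs (c *\<^sub>R x) \<le> \<bar>c\<bar> *\<^sub>R lat_abs x" for x :: 'a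
proof (cases "0 \<le> c")
  case True
  then show ?thesis
    using scaleR_mono[OF lat_abs_ge(1)[of x], of c] scaleR_mono[OF lat_abs_ge(2)[of x], of c]
    by (simp add: lat_abs_le_iff)
next
  case False
  then show ?thesis
    using scaleR_mono[OF lat_abs_ge(1)[of x], of "- c"] scaleR_mono[OF lat_abs_ge(2)[of x], of "- c"]
    by (simp add: lat_abs_le_iff)
qed

text \<open>Split both factors into positive and negative parts: |x||y| - x y and |x||y| + x y are
  each twice a sum of products of positive elements.\<close>

lemma lat_abs_mult_le: "lat_abs (x * y) \<le> lat_abs x * lat_abs y" for x y :: 'a
proof -
  define a b c d where "a = pprt x" "b = pprt (- x)" "c = pprt y" "d = pprt (- y)"
  note defs = this
  have x: "x = a - b" "lat_abs x = a + b" and y: "y = c - d" "lat_abs y = c + d"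
    using pprt_diff_nprt lat_abs_eq_pprt by (simp_all add: defs)
  have nn: "0 \<le> a * c" "0 \<le> a * d" "0 \<le> b * c" "0 \<le> b * d"
    by (auto simp: defs intro: mult_nonneg)
  have "lat_abs x * lat_abs y - x * y = (a * d + b * c) + (a * d + b * c)"
    "lat_abs x * lat_abs y - (- (x * y)) = (a * c + b * d) + (a * c + b * d)"
    by (simp_all only: x(2) y(2)) (simp_all add: x(1) y(1) algebra_simps)
  then have "0 \<le> lat_abs x * lat_abs y - x * y" "0 \<le> lat_abs x * lat_abs y - (- (x * y))"
    using nn by (metis add_nonneg_nonneg)+
  then show ?thesis
    unfolding lat_abs_le_iff by (simp only: diff_ge_0_iff_ge)
qed

lemma norm_lat_abs: "norm (lat_abs x) = norm x" for x :: 'a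
  by (intro antisym lattice_norm) (simp_all add: lat_abs_idem)

lemma norm_mono_nonneg: "0 \<le> x \<Longrightarrow> x \<le> y \<Longrightarrow> norm x \<le> norm y" for x :: 'a
  by (rule lattice_norm) (metis lat_abs_of_nonneg order_trans)

text \<open>The negative part of the limit is dominated by |X n - x| for every n, so its norm is
  zero.\<close>

lemma closed_nonneg: "closed {x::'a. 0 \<le> x}"
  unfolding closed_sequential_limits
proof (intro allI impI, elim conjE)
  fix X :: "nat \<Rightarrow> 'a" and x
  assume nn: "\<forall>n. X n \<in> {x. 0 \<le> x}" and lim: "X \<longlonglongrightarrow> x"
  have bound: "norm (pprt (- x)) \<le> norm (X n - x)" for n
  proof -
    have "- x \<le> X n - x"
      using nn by simp
    also have "\<dots> \<le> lat_abs (X n - x)"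
      by (rule lat_abs_ge)
    finally have "pprt (- x) \<le> lat_abs (X n - x)"
      by (simp add: pprt_def lat_abs_nonneg)
    from norm_mono_nonneg[OF _ this] show ?thesis
      by (simp add: norm_lat_abs)
  qed
  have "(\<lambda>n. norm (X n - x)) \<longlonglongrightarrow> 0"
    using lim by (simp add: LIM_zero_iff tendsto_norm_zero_iff)
  then have "norm (pprt (- x)) \<le> 0"
    by (rule LIMSEQ_le_const) (use bound in auto)
  then show "x \<in> {x. 0 \<le> x}"
    using le_zero_iff_pprt_id[of x] pprt_diff_nprt[of x] by simp
qed

lemma tendsto_le_order:
  fixes x y :: 'a
  assumes "X \<longlonglongrightarrow> x" "Y \<longlonglongrightarrow> y" "\<And>n::nat. X n \<le> Y n"
  shows "x \<le> y"
proof -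
  have "(\<lambda>n. Y n - X n) \<longlonglongrightarrow> y - x"
    by (intro tendsto_diff assms)
  then have "y - x \<in> {x. 0 \<le> x}"
    by (rule closed_sequentially[OF closed_nonneg, rotated]) (use assms(3) in auto)
  then show ?thesis by simp
qed

text \<open>The Archimedean property, obtained from closedness of the positive cone.\<close>

lemma le_scaleR_limit:
  fixes x y :: 'a
  assumes y: "0 \<le> y" and le: "\<And>l. c < l \<Longrightarrow> x \<le> l *\<^sub>R y"
  shows "x \<le> c *\<^sub>R y"
proof (rule tendsto_le_order[of "\<lambda>n. x"])
  have "(\<lambda>n. c + 1 / real (Suc n)) \<longlonglongrightarrow> c + 0"
    by (intro tendsto_add tendsto_const LIMSEQ_Suc lim_1_over_n)
  then show "(\<lambda>n. (c + 1 / real (Suc n)) *\<^sub>R y) \<longlonglongrightarrow> c *\<^sub>R y"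
    by (auto intro: tendsto_scaleR)
qed (auto intro!: le)

text \<open>Positivity of the unit: with \<open>q\<close> its negative part, \<open>\<bar>1\<bar> = 1 + 2q\<close> has norm one, while
  its powers dominate \<open>1 + 2nq\<close>.\<close>

lemma one_nonneg: "0 \<le> (1::'a)"
proof -
  define q :: 'a where "q = pprt (- 1)"
  have q: "0 \<le> q" by (simp add: q_def)
  have abs1: "lat_abs (1::'a) = 1 + 2 *\<^sub>R q"
    using pprt_diff_nprt[of "1::'a"] lat_abs_eq_pprt[of "1::'a"] unfolding q_def
    by (metis add.assoc diff_add_cancel scaleR_2)
  have pow: "0 \<le> (1 + 2 *\<^sub>R q) ^ n - (1 + (2 * real n) *\<^sub>R q)" for n
  proof (induction n)
    case (Suc n)
    define P where "P = (1 + 2 *\<^sub>R q) ^ n - (1 + (2 * real n) *\<^sub>R q)"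
    have "(1 + 2 *\<^sub>R q) ^ Suc n = (1 + 2 *\<^sub>R q) * (P + (1 + (2 * real n) *\<^sub>R q))"
      by (simp add: P_def)
    \<comment> \<open>The factor multiplying \<open>P\<close> is written as
      \<open>lat_abs 1\<close>, because 1 itself is not yet known to be positive while |1|
      is.\<close>
    then have "(1 + 2 *\<^sub>R q) ^ Suc n - (1 + (2 * real (Suc n)) *\<^sub>R q)
        = lat_abs 1 * P + (4 * real n) *\<^sub>R (q * q)"
      unfolding abs1 by (simp add: algebra_simps)
    moreover have "0 \<le> lat_abs 1 * P"
      using Suc by (auto simp: P_def lat_abs_nonneg intro: mult_nonneg)
    moreover have "0 \<le> (4 * real n) *\<^sub>R (q * q)"
      using q by (auto intro: scaleR_nonneg mult_nonneg)
    ultimately show ?case by simp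
  qed simp
  have bound: "2 * real n * norm q \<le> 2" for n
  proof -
    have "norm ((2 * real n) *\<^sub>R q) \<le> norm ((1 + 2 *\<^sub>R q) ^ n - 1)"
      using pow[of n] q by (intro norm_mono_nonneg scaleR_nonneg) (auto simp: algebra_simps)
    also have "\<dots> \<le> norm ((1 + 2 *\<^sub>R q) ^ n) + 1"
      using norm_triangle_ineq4[of "(1 + 2 *\<^sub>R q) ^ n" 1] by simp
    also have "norm ((1 + 2 *\<^sub>R q) ^ n) \<le> norm (lat_abs (1::'a)) ^ n"
      unfolding abs1 by (rule norm_power_ineq)
    also have "\<dots> = 1" by (simp add: norm_lat_abs)
    finally show ?thesis by simp
  qed
  have "norm q = 0"
  proof (rule ccontr)
    assume "norm q \<noteq> 0"
    then obtain n where "2 < real n * norm q"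
      using reals_Archimedean3[of "norm q"] by auto
    with bound[of n] show False by (simp add: mult.assoc)
  qed
  then show ?thesis
    using pprt_diff_nprt[of "1::'a"] zero_le_pprt[of "1::'a"] by (simp add: q_def)
qed

section \<open>The order ideal generated by the unit\<close>

text \<open>No sign is asked of \<open>l\<close>: because 1 is positive, \<open>max l 0\<close>
  serves as the nonnegative bound.\<close>

lemma AeI: "lat_abs x \<le> l *\<^sub>R 1 \<Longrightarrow> x \<in> Ae" for x :: 'a
  unfolding Ae_def
  by (intro CollectI exI[of _ "max l 0"]) (auto intro: order_trans[OF _ scaleR_mono_left[OF _ one_nonneg]])

lemma Ae_nonnegI: "0 \<le> x \<Longrightarrow> x \<le> l *\<^sub>R 1 \<Longrightarrow> x \<in> Ae" for x :: 'a
  by (rule AeI) (simp add: lat_abs_of_nonneg)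

lemma AeE:
  assumes "(x::'a) \<in> Ae"
  obtains l where "0 \<le> l" "lat_abs x \<le> l *\<^sub>R 1"
  using assms by (auto simp: Ae_def)

lemma Ae_solid: "y \<in> Ae \<Longrightarrow> lat_abs x \<le> lat_abs y \<Longrightarrow> x \<in> Ae" for x :: 'a
  by (metis AeE AeI order_trans)

lemma Ae_one: "(1::'a) \<in> Ae"
  by (rule AeI[of _ 1]) (simp add: lat_abs_of_nonneg one_nonneg)

lemma Ae_add: "x \<in> Ae \<Longrightarrow> y \<in> Ae \<Longrightarrow> x + y \<in> Ae" for x :: 'a
proof -
  assume "x \<in> Ae" "y \<in> Ae"
  then obtain l m where "lat_abs x \<le> l *\<^sub>R 1" "lat_abs y \<le> m *\<^sub>R 1"
    by (metis AeE)
  then have "lat_abs x + lat_abs y \<le> (l + m) *\<^sub>R 1"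
    by (simp add: scaleR_left_distrib add_mono)
  then show ?thesis
    by (rule AeI[OF order_trans[OF lat_abs_triangle]])
qed

lemma Ae_scaleR: "x \<in> Ae \<Longrightarrow> c *\<^sub>R x \<in> Ae" for x :: 'a
proof -
  assume "x \<in> Ae"
  then obtain l where "lat_abs x \<le> l *\<^sub>R 1" by (metis AeE)
  then have "\<bar>c\<bar> *\<^sub>R lat_abs x \<le> (\<bar>c\<bar> * l) *\<^sub>R 1"
    using scaleR_mono[of _ "l *\<^sub>R 1" "\<bar>c\<bar>"] by simp
  then show ?thesis
    by (rule AeI[OF order_trans[OF lat_abs_scaleR_le]])
qed

lemma Ae_scaleR_one: "c *\<^sub>R (1::'a) \<in> Ae"
  by (simp add: Ae_scaleR Ae_one)

lemma Ae_minus: "x \<in> Ae \<Longrightarrow> - x \<in> Ae" for x :: 'a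
  using Ae_scaleR[of x "-1"] by simp

lemma Ae_diff: "x \<in> Ae \<Longrightarrow> y \<in> Ae \<Longrightarrow> x - y \<in> Ae" for x :: 'a
  using Ae_add[of x "- y"] Ae_minus by simp

lemma Ae_lat_abs: "x \<in> Ae \<Longrightarrow> lat_abs x \<in> Ae" for x :: 'a
  by (rule Ae_solid) (auto simp: lat_abs_idem)

lemma Ae_pprt: "x \<in> Ae \<Longrightarrow> pprt x \<in> Ae" for x :: 'a
  by (rule Ae_solid[of x]) (simp_all add: lat_abs_of_nonneg pprt_le_lat_abs)

text \<open>Here \<open>y\<close> ranges over the whole algebra: multiplication by an element of
  \<open>Ae\<close>, on either side, keeps \<open>y\<close> inside the order ideal that
  \<open>y\<close> generates.\<close>

lemma lat_abs_mult_Ae_le: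
  fixes x y :: 'a
  assumes "lat_abs x \<le> l *\<^sub>R 1"
  shows "lat_abs (x * y) \<le> l *\<^sub>R lat_abs y" "lat_abs (y * x) \<le> l *\<^sub>R lat_abs y"
  using order_trans[OF lat_abs_mult_le[of x y] mult_mono_nonneg_right[OF lat_abs_nonneg[of y] assms]]
    order_trans[OF lat_abs_mult_le[of y x] mult_mono_nonneg_left[OF lat_abs_nonneg[of y] assms]]
  by simp_all

lemma Ae_mult: "x \<in> Ae \<Longrightarrow> y \<in> Ae \<Longrightarrow> x * y \<in> Ae" for x :: 'a
proof -
  assume x: "x \<in> Ae" and y: "y \<in> Ae"
  obtain l where l: "0 \<le> l" "lat_abs x \<le> l *\<^sub>R 1" using x by (rule AeE)
  have "lat_abs (x * y) \<le> lat_abs (l *\<^sub>R lat_abs y)"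
    using lat_abs_mult_Ae_le(1)[OF l(2), of y] l(1)
    by (simp add: lat_abs_of_nonneg scaleR_nonneg lat_abs_nonneg)
  then show ?thesis
    by (rule Ae_solid[rotated]) (simp add: Ae_scaleR Ae_lat_abs y)
qed

text \<open>The product lies below a multiple of \<open>x\<close> and below a multiple of
  \<open>y\<close>, so a small positive multiple of it lies below \<open>inf x y\<close>.\<close>

lemma Ae_disjoint_mult:
  fixes x y :: 'a
  assumes "x \<in> Ae" "y \<in> Ae" "inf x y = 0"
  shows "x * y = 0"
proof -
  have nn: "0 \<le> x" "0 \<le> y"
    using assms(3) by (metis inf.cobounded1, metis inf.cobounded2)
  obtain l where l: "0 \<le> l" "lat_abs x \<le> l *\<^sub>R 1" using assms(1) by (rule AeE)
  obtain m where m: "0 \<le> m" "lat_abs y \<le> m *\<^sub>R 1" using assms(2) by (rule AeE)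
  \<comment> \<open>One constant above both bounds; the summand 1 makes it positive, so that
    division by it is possible.\<close>
  define c where "c = l + m + 1"
  have c: "0 < c" "l \<le> c" "m \<le> c" using l m by (auto simp: c_def)
  have "x * y \<le> l *\<^sub>R y" "x * y \<le> m *\<^sub>R x"
    using lat_abs_mult_Ae_le(1)[OF l(2), of y] lat_abs_mult_Ae_le(2)[OF m(2), of x] nn
    by (simp_all add: lat_abs_of_nonneg mult_nonneg)
  then have le: "x * y \<le> c *\<^sub>R y" "x * y \<le> c *\<^sub>R x"
    using scaleR_mono_left[OF c(2) nn(2)] scaleR_mono_left[OF c(3) nn(1)] by (auto intro: order_trans)
  have "(1/c) *\<^sub>R (x * y) \<le> x" "(1/c) *\<^sub>R (x * y) \<le> y"
    using scaleR_mono[OF le(1), of "1/c"] scaleR_mono[OF le(2), of "1/c"] c by auto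
  then have "(1/c) *\<^sub>R (x * y) \<le> 0"
    using assms(3) by (metis inf.boundedI)
  then have "x * y \<le> 0"
    using scaleR_mono[of _ 0 c] c by force
  with mult_nonneg[OF nn] show ?thesis by (rule order.antisym[rotated])
qed

lemma pprt_mult_pprt_minus:
  "x \<in> Ae \<Longrightarrow> pprt x * pprt (- x) = 0" "x \<in> Ae \<Longrightarrow> pprt (- x) * pprt x = 0" for x :: 'a
  by (rule Ae_disjoint_mult;
      simp add: Ae_pprt Ae_minus pprt_inf_pprt_minus inf_commute[of "pprt (- x)"])+

lemma Ae_le_one_if_norm_less_1:
  fixes x :: 'a
  assumes x: "x \<in> Ae" "0 \<le> x" and n: "norm x < 1"
  shows "x \<le> 1"
proof -
  define u where "u = pprt (x - 1)"
  \<comment> \<open>Only the first factor is split; its negative part is disjoint from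
    \<open>u\<close>, so the cross term will vanish.\<close>
  have "(x - 1) * u = u * u - pprt (- (x - 1)) * u"
    unfolding u_def by (subst pprt_diff_nprt[of "x - 1"]) (simp add: left_diff_distrib)
  also have "\<dots> = u * u"
    unfolding u_def using pprt_mult_pprt_minus(2)[OF Ae_diff[OF x(1) Ae_one]] by simp
  finally have "x * u - u = u * u"
    by (simp add: left_diff_distrib)
  moreover have u: "0 \<le> u" by (simp add: u_def)
  ultimately have "u \<le> x * u"
    using mult_nonneg[of u u] by (metis diff_ge_0_iff_ge)
  then have "norm u \<le> norm (x * u)"
    by (rule norm_mono_nonneg[OF u])
  also have "\<dots> \<le> norm x * norm u"
    by (rule norm_mult_ineq)
  finally have "(1 - norm x) * norm u \<le> 0"
    by (simp add: left_diff_distrib)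
  then have "u = 0"
    using n by (simp add: mult_le_0_iff)
  then show ?thesis
    using le_zero_iff_zero_pprt[of "x - 1"] by (simp add: u_def)
qed

text \<open>Dividing by any l > norm x reduces to an element of norm below 1; the Archimedean
  property then lets l decrease to norm x.\<close>

lemma Ae_le_norm:
  fixes x :: 'a
  assumes x: "x \<in> Ae"
  shows "lat_abs x \<le> norm x *\<^sub>R 1"
proof (rule le_scaleR_limit[OF one_nonneg])
  fix l assume l: "norm x < l"
  then have l0: "0 < l" using norm_ge_zero[of x] by linarith
  have "(1/l) *\<^sub>R lat_abs x \<le> 1"
    using l l0 x by (intro Ae_le_one_if_norm_less_1)
      (auto simp: Ae_scaleR Ae_lat_abs norm_lat_abs divide_simps intro!: scaleR_nonneg lat_abs_nonneg)
  from scaleR_mono[OF this, of l] show "lat_abs x \<le> l *\<^sub>R 1"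
    using l0 by simp
qed

text \<open>From right to left this is monotonicity of the norm together with norm 1 = 1.\<close>

lemma Ae_norm_le_iff:
  fixes x :: 'a
  assumes x: "x \<in> Ae" and l: "0 \<le> l"
  shows "norm x \<le> l \<longleftrightarrow> lat_abs x \<le> l *\<^sub>R 1"
proof
  assume "norm x \<le> l"
  then show "lat_abs x \<le> l *\<^sub>R 1"
    using order_trans[OF Ae_le_norm[OF x] scaleR_mono_left[OF _ one_nonneg]] by blast
next
  assume "lat_abs x \<le> l *\<^sub>R 1"
  from norm_mono_nonneg[OF lat_abs_nonneg this] show "norm x \<le> l"
    using l by (simp add: norm_lat_abs)
qed

lemma Ae_norm_eq_Inf:
  fixes x :: 'a
  assumes x: "x \<in> Ae"
  shows "norm x = Inf {l::real. l > 0 \<and> lat_abs x \<le> l *\<^sub>R 1}"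
proof -
  have "{l::real. l > 0 \<and> lat_abs x \<le> l *\<^sub>R 1} = {l. l > 0 \<and> norm x \<le> l}"
    using Ae_norm_le_iff[OF x] by auto
  also have "Inf \<dots> = norm x"
  proof (rule cInf_eq_non_empty)
    show "{l. 0 < l \<and> norm x \<le> l} \<noteq> {}"
      by (auto intro!: exI[of _ "norm x + 1"] simp: add_nonneg_pos)
  next
    fix y assume y: "\<And>l. l \<in> {l. 0 < l \<and> norm x \<le> l} \<Longrightarrow> y \<le> l"
    show "y \<le> norm x"
    \<comment> \<open>The set contains only positive scalars, so for \<open>x = 0\<close> the
      infimum is not attained and has to be approached.\<close>
    proof (rule field_le_epsilon)
      fix e :: real assume "0 < e"
      then show "y \<le> norm x + e"
        by (intro y) (auto simp: add_nonneg_pos)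
    qed
  qed auto
  finally show ?thesis by simp
qed

text \<open>Each element is bounded by its own norm times 1, and these bounds converge along with
  the sequence.\<close>

lemma closed_Ae: "closed (Ae :: 'a set)"
  unfolding closed_sequential_limits
proof (intro allI impI, elim conjE)
  fix X :: "nat \<Rightarrow> 'a" and x
  assume X: "\<forall>n. X n \<in> Ae" and lim: "X \<longlonglongrightarrow> x"
  have le: "X n \<le> norm (X n) *\<^sub>R 1" "- X n \<le> norm (X n) *\<^sub>R 1" for n
    using Ae_le_norm[of "X n"] X by (simp_all add: lat_abs_le_iff)
  have nlim: "(\<lambda>n. norm (X n) *\<^sub>R (1::'a)) \<longlonglongrightarrow> norm x *\<^sub>R 1"
    by (intro tendsto_scaleR tendsto_norm lim tendsto_const)
  show "x \<in> Ae"
    by (rule AeI[of _ "norm x"], unfold lat_abs_le_iff)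
      (use tendsto_le_order[OF lim nlim le(1)] tendsto_le_order[OF tendsto_minus[OF lim] nlim le(2)] in auto)
qed

section \<open>The band decomposition\<close>

text \<open>The truncation at height norm a is already the largest one. Adding \<open>b\<close> to
  \<open>inf (a - b) 1\<close> gives something below another truncation of \<open>a\<close>, hence
  below \<open>b\<close>, so nothing of \<open>a - b\<close> meets 1.\<close>

lemma nonneg_decomposition:
  fixes a :: 'a
  assumes a: "0 \<le> a"
  obtains b c where "b \<in> Ae" "0 \<le> c" "inf c 1 = 0" "a = b + c"
proof -
  define b where "b = inf a (norm a *\<^sub>R 1)"
  have trunc: "inf a (l *\<^sub>R 1) \<le> b" if l: "0 \<le> l" for l
  proof -
    have nn: "0 \<le> inf a (l *\<^sub>R 1)"
      using a l by (simp add: scaleR_nonneg one_nonneg)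
    then have "inf a (l *\<^sub>R 1) \<in> Ae"
      by (rule Ae_nonnegI[of _ l]) simp
    moreover have "norm (inf a (l *\<^sub>R 1)) \<le> norm a"
      by (rule norm_mono_nonneg[OF nn]) simp
    ultimately have "lat_abs (inf a (l *\<^sub>R 1)) \<le> norm a *\<^sub>R 1"
      using Ae_norm_le_iff[of _ "norm a"] by simp
    then show ?thesis
      by (simp add: b_def lat_abs_of_nonneg[OF nn])
  qed
  have b: "b \<in> Ae"
    by (rule Ae_nonnegI[of _ "norm a"]) (simp_all add: b_def a scaleR_nonneg one_nonneg)
  have ab: "b \<le> a" by (simp add: b_def)
  have "inf (a - b) 1 + b = inf a (1 + b)"
    by (simp add: add_inf_distrib_right)
  \<comment> \<open>\<open>b\<close> was cut at height norm a, so \<open>1 + b\<close> stays below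
    height norm a + 1.\<close>
  also have "\<dots> \<le> inf a ((norm a + 1) *\<^sub>R 1)"
    by (intro inf_mono order_refl) (simp add: b_def scaleR_left_distrib add.commute)
  also have "\<dots> \<le> b" by (rule trunc) simp
  finally have "inf (a - b) 1 \<le> 0"
    by simp
  moreover have "0 \<le> inf (a - b) 1"
    using ab one_nonneg by simp
  ultimately have "inf (a - b) 1 = 0" by (rule order.antisym)
  then show thesis
    using that[of b "a - b"] b ab by simp
qed

text \<open>The disjoint complement of \<open>Ae\<close>. Testing against 1 alone is enough, because
  1 generates \<open>Ae\<close> as an order ideal.\<close>

definition Ad :: "'a set" where
  "Ad = {x. inf (lat_abs x) 1 = 0}"

lemma Ad_solid: "y \<in> Ad \<Longrightarrow> lat_abs x \<le> lat_abs y \<Longrightarrow> x \<in> Ad"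
  unfolding Ad_def using disjoint_mono[OF lat_abs_nonneg _ one_nonneg order_refl] by blast

lemma Ad_add: "x \<in> Ad \<Longrightarrow> y \<in> Ad \<Longrightarrow> x + y \<in> Ad"
  using Ad_solid[of "lat_abs x + lat_abs y" "x + y"] disjoint_add[OF lat_abs_nonneg lat_abs_nonneg one_nonneg]
  unfolding Ad_def
  by (simp add: lat_abs_of_nonneg lat_abs_nonneg lat_abs_triangle add_nonneg_nonneg)

lemma Ad_minus: "x \<in> Ad \<Longrightarrow> - x \<in> Ad"
  by (simp add: Ad_def lat_abs_minus)

lemma Ad_diff: "x \<in> Ad \<Longrightarrow> y \<in> Ad \<Longrightarrow> x - y \<in> Ad"
  using Ad_add[of x "- y"] Ad_minus by simp

lemma disjoint_scaleR:
  fixes a :: 'a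
  assumes "inf a b = 0" "0 \<le> c"
  shows "inf (c *\<^sub>R a) b = 0"
proof -
  have nn: "0 \<le> a" "0 \<le> b"
    using assms(1) by (metis inf.cobounded1, metis inf.cobounded2)
  \<comment> \<open>A common factor for both arguments: a lower bound of d a and d b, divided by d,
    is a lower bound of a and b.\<close>
  define d where "d = c + 1"
  have d: "1 \<le> d" "c \<le> d" "0 < d" using assms(2) by (auto simp: d_def)
  have lb: "x \<le> 0" if "x \<le> d *\<^sub>R a" "x \<le> d *\<^sub>R b" for x
  proof -
    have "(1/d) *\<^sub>R x \<le> a" "(1/d) *\<^sub>R x \<le> b"
      using scaleR_mono[OF that(1), of "1/d"] scaleR_mono[OF that(2), of "1/d"] d by auto
    then have "(1/d) *\<^sub>R x \<le> 0" using assms(1) by (metis inf.boundedI)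
    then show ?thesis using scaleR_mono[of _ 0 d] d by force
  qed
  have "inf (c *\<^sub>R a) b \<le> 0"
    using scaleR_mono_left[OF d(2) nn(1)] scaleR_mono_left[OF d(1) nn(2)]
    by (intro lb) (auto intro: le_infI1 le_infI2)
  moreover have "0 \<le> inf (c *\<^sub>R a) b"
    using nn assms(2) by (simp add: scaleR_nonneg)
  ultimately show ?thesis by (rule order.antisym)
qed

lemma Ad_disjoint_Ae:
  fixes x y :: 'a
  assumes "x \<in> Ad" "0 \<le> y" "y \<le> l *\<^sub>R 1"
  shows "inf (lat_abs x) y = 0"
proof -
  have "inf (max l 0 *\<^sub>R 1) (lat_abs x) = 0"
    using assms(1) by (intro disjoint_scaleR) (auto simp: Ad_def inf_commute)
  moreover have "y \<le> max l 0 *\<^sub>R 1"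
    using assms(3) scaleR_mono_left[OF max.cobounded1 one_nonneg] by (rule order_trans)
  ultimately show ?thesis
    using disjoint_mono[OF assms(2) _ lat_abs_nonneg order_refl] by (metis inf_commute)
qed

text \<open>For such an element |x| is disjoint from itself.\<close>

lemma Ae_Int_Ad: "x \<in> Ae \<Longrightarrow> x \<in> Ad \<Longrightarrow> x = 0" for x :: 'a
  by (metis AeE Ad_disjoint_Ae inf.idem lat_abs_eq_0_iff lat_abs_nonneg)

text \<open>Because |x y| <= l |y|, the product inherits disjointness from 1. This keeps b v in the
  complementary band in the proof of inverse closedness.\<close>

lemma Ad_mult_Ae: "x \<in> Ae \<Longrightarrow> y \<in> Ad \<Longrightarrow> x * y \<in> Ad" for x :: 'a
proof -
  assume x: "x \<in> Ae" and y: "y \<in> Ad"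
  obtain l where l: "0 \<le> l" "lat_abs x \<le> l *\<^sub>R 1" using x by (rule AeE)
  have nn: "lat_abs (l *\<^sub>R lat_abs y) = l *\<^sub>R lat_abs y"
    using l by (simp add: lat_abs_of_nonneg scaleR_nonneg lat_abs_nonneg)
  have "l *\<^sub>R lat_abs y \<in> Ad"
    using y l disjoint_scaleR[of "lat_abs y" 1 l] unfolding Ad_def by (simp add: nn)
  then show ?thesis
    by (rule Ad_solid) (use lat_abs_mult_Ae_le(1)[OF l(2), of y] nn in simp)
qed

lemma decomposition:
  fixes x :: 'a
  obtains b c where "b \<in> Ae" "c \<in> Ad" "x = b + c"
proof -
  obtain b c where 1: "b \<in> Ae" "0 \<le> c" "inf c 1 = 0" "pprt x = b + c"
    using nonneg_decomposition[of "pprt x"] by auto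
  obtain b' c' where 2: "b' \<in> Ae" "0 \<le> c'" "inf c' 1 = 0" "pprt (- x) = b' + c'"
    using nonneg_decomposition[of "pprt (- x)"] by auto
  have "x = (b - b') + (c - c')"
    using pprt_diff_nprt[of x] 1(4) 2(4) by simp
  moreover have "c \<in> Ad" "c' \<in> Ad"
    using 1 2 by (simp_all add: Ad_def lat_abs_of_nonneg)
  ultimately show thesis using that 1(1) 2(1) Ae_diff Ad_diff by blast
qed

section \<open>The complexification\<close>

text \<open>An order version of Lipschitz continuity in the angle. It bounds the error made when the
  full circle is replaced by a finite net.\<close>

lemma cos_sin_combination_le:
  fixes x y :: 'a
  shows "cos t *\<^sub>R x + sin t *\<^sub>R y
    \<le> (cos s *\<^sub>R x + sin s *\<^sub>R y) + \<bar>t - s\<bar> *\<^sub>R (lat_abs x + lat_abs y)"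
proof -
  have lip: "a *\<^sub>R u \<le> b *\<^sub>R u + \<bar>t - s\<bar> *\<^sub>R lat_abs u"
    if "\<bar>a - b\<bar> \<le> \<bar>t - s\<bar>" for a b and u :: 'a
  proof -
    have "(a - b) *\<^sub>R u \<le> \<bar>a - b\<bar> *\<^sub>R lat_abs u"
      using lat_abs_ge(1) lat_abs_scaleR_le by (rule order_trans)
    also have "\<dots> \<le> \<bar>t - s\<bar> *\<^sub>R lat_abs u"
      by (rule scaleR_mono_left[OF that lat_abs_nonneg])
    finally show ?thesis
      by (simp add: scaleR_left_diff_distrib diff_le_eq add.commute)
  qed
  \<comment> \<open>Both signs are recorded because the difference formulas for cosine and sine
    produce the half difference in opposite orders.\<close>
  have half: "2 * \<bar>sin ((t - s) / 2)\<bar> \<le> \<bar>t - s\<bar>" "2 * \<bar>sin ((s - t) / 2)\<bar> \<le> \<bar>t - s\<bar>"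
    using abs_sin_x_le_abs_x[of "(t - s) / 2"] abs_sin_x_le_abs_x[of "(s - t) / 2"] by auto
  have "\<bar>cos t - cos s\<bar> = (2 * \<bar>sin ((s - t) / 2)\<bar>) * \<bar>sin ((t + s) / 2)\<bar>"
    by (simp add: cos_diff_cos abs_mult)
  also have "\<dots> \<le> (2 * \<bar>sin ((s - t) / 2)\<bar>) * 1"
    by (intro mult_left_mono) auto
  finally have c: "\<bar>cos t - cos s\<bar> \<le> \<bar>t - s\<bar>" using half by simp
  have "\<bar>sin t - sin s\<bar> = (2 * \<bar>sin ((t - s) / 2)\<bar>) * \<bar>cos ((t + s) / 2)\<bar>"
    by (simp add: sin_diff_sin abs_mult)
  also have "\<dots> \<le> (2 * \<bar>sin ((t - s) / 2)\<bar>) * 1"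
    by (intro mult_left_mono) auto
  finally have s: "\<bar>sin t - sin s\<bar> \<le> \<bar>t - s\<bar>" using half by simp
  show ?thesis
    using add_mono[OF lip[OF c, of x] lip[OF s, of y]] by (simp add: algebra_simps)
qed

text \<open>Finite suprema over ever finer nets of angles form a Cauchy sequence, whose limit is the
  supremum over all angles.\<close>

lemma modulus_exists:
  fixes x y :: 'a
  obtains m where "\<And>t. t \<in> {0..2*pi} \<Longrightarrow> cos t *\<^sub>R x + sin t *\<^sub>R y \<le> m"
    and "\<And>u. (\<And>t. t \<in> {0..2*pi} \<Longrightarrow> cos t *\<^sub>R x + sin t *\<^sub>R y \<le> u) \<Longrightarrow> m \<le> u"
proof -
  define f where "f t = cos t *\<^sub>R x + sin t *\<^sub>R y" for t
  define L where "L = lat_abs x + lat_abs y"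
  define d where "d n = 2 * pi / real (Suc n)" for n
  \<comment> \<open>Equally spaced angles with both end points of the interval included; the mesh is
    \<open>d n\<close>.\<close>
  define net where "net n = (\<lambda>j. real j * d n) ` {..Suc n}" for n
  define m where "m n = Sup_fin (f ` net n)" for n
  have fin: "finite (f ` net n)" "f ` net n \<noteq> {}" for n
    by (auto simp: net_def)
  have L: "0 \<le> L"
    by (simp add: L_def add_nonneg_nonneg lat_abs_nonneg)
  have d: "0 < d n" for n by (simp add: d_def)
  have net_sub: "net n \<subseteq> {0..2*pi}" for n
  proof -
    have "real j * d n \<le> 2 * pi" if "j \<le> Suc n" for j
    proof -
      have "real j * d n \<le> real (Suc n) * d n"
        using that d[of n] by (intro mult_right_mono) auto
      then show ?thesis by (simp add: d_def)
    qed
    then show ?thesis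
      using d[of n] by (auto simp: net_def)
  qed
  have le: "f t \<le> m n + d n *\<^sub>R L" if t: "t \<in> {0..2*pi}" for t n
  proof -
    \<comment> \<open>The index of the last net point not beyond \<open>t\<close>.\<close>
    define j where "j = nat \<lfloor>t / d n\<rfloor>"
    have j: "real j \<le> t / d n" "t / d n < real j + 1"
      using t d[of n] by (auto simp: j_def)
    have "real (Suc n) * d n = 2 * pi"
      by (simp add: d_def)
    then have "t / d n \<le> real (Suc n)"
      using t d[of n] by (simp add: pos_divide_le_eq del: of_nat_Suc)
    then have "j \<le> Suc n"
      using j(1) by linarith
    then have "f (real j * d n) \<le> m n"
      unfolding m_def by (intro Sup_fin.coboundedI fin) (auto simp: net_def)
    moreover have "\<bar>t - real j * d n\<bar> \<le> d n"
      using j d[of n] by (auto simp: field_simps)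
    then have "\<bar>t - real j * d n\<bar> *\<^sub>R L \<le> d n *\<^sub>R L"
      by (rule scaleR_mono_left[OF _ L])
    ultimately show ?thesis
      using cos_sin_combination_le[of t x y "real j * d n"] unfolding f_def[symmetric] L_def[symmetric]
      by (meson add_mono order_trans)
  qed
  have least: "m n \<le> u" if "\<And>t. t \<in> {0..2*pi} \<Longrightarrow> f t \<le> u" for n u
    unfolding m_def using net_sub[of n] by (intro Sup_fin.boundedI fin) (auto intro: that)
  have dist: "norm (m k - m n) \<le> (d k + d n) * norm L" for k n
  proof -
    \<comment> \<open>Both right-hand sides bound the combinations at all angles, so two nets can be
      compared although neither refines the other.\<close>
    have "m k \<le> m n + d n *\<^sub>R L" "m n \<le> m k + d k *\<^sub>R L"
      by (rule least, erule le)+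
    moreover have "0 \<le> d k *\<^sub>R L" "0 \<le> d n *\<^sub>R L"
      using d[of k] d[of n] L by (auto intro!: scaleR_nonneg)
    ultimately have "lat_abs (m k - m n) \<le> (d k + d n) *\<^sub>R L"
      unfolding lat_abs_le_iff scaleR_left_distrib
      by (simp add: diff_le_eq) (metis add.assoc add.commute add_increasing2 add_left_mono order_trans)
    from norm_mono_nonneg[OF lat_abs_nonneg this] show ?thesis
      using d[of k] d[of n] by (simp add: norm_lat_abs)
  qed
  have d0: "d \<longlonglongrightarrow> 0"
    unfolding d_def[abs_def] using LIMSEQ_Suc[OF lim_const_over_n[of "2 * pi"]] by simp
  have "Cauchy m"
    unfolding Cauchy_iff
  proof (intro allI impI)
    fix e :: real assume e: "0 < e"
    have "(\<lambda>n. d n * (norm L + 1)) \<longlonglongrightarrow> 0"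
      using tendsto_mult_right[OF d0, of "norm L + 1"] by simp
    then have "eventually (\<lambda>n. d n * (norm L + 1) < e / 2) sequentially"
      using e by (intro order_tendstoD) auto
    then obtain N where N: "\<And>n. N \<le> n \<Longrightarrow> d n * (norm L + 1) < e / 2"
      by (auto simp: eventually_sequentially)
    have "norm (m k - m n) < e" if "N \<le> k" "N \<le> n" for k n
    proof -
      have "norm (m k - m n) \<le> (d k + d n) * (norm L + 1)"
        using dist[of k n] d[of k] d[of n] by (simp add: algebra_simps)
      also have "\<dots> < e"
        using N[OF that(1)] N[OF that(2)] by (simp add: distrib_right)
      finally show ?thesis .
    qed
    then show "\<exists>M. \<forall>k\<ge>M. \<forall>n\<ge>M. norm (m k - m n) < e" by blast
  qed
  then obtain M where M: "m \<longlonglongrightarrow> M"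
    using Cauchy_convergent convergent_def by blast
  have "(\<lambda>n. m n + d n *\<^sub>R L) \<longlonglongrightarrow> M + 0 *\<^sub>R L"
    by (intro tendsto_intros M d0)
  then have "f t \<le> M" if "t \<in> {0..2*pi}" for t
    using tendsto_le_order[OF tendsto_const _ le[OF that]] by simp
  moreover have "M \<le> u" if "\<And>t. t \<in> {0..2*pi} \<Longrightarrow> f t \<le> u" for u
    by (rule tendsto_le_order[OF M tendsto_const least]) (rule that)
  ultimately show thesis
    using that[of M] by (simp add: f_def)
qed

lemma cabs_spec:
  fixes z :: "'a \<times> 'a"
  shows "(\<forall>t\<in>{0..2*pi}. cos t *\<^sub>R fst z + sin t *\<^sub>R snd z \<le> cabs z) \<and>
    (\<forall>u. (\<forall>t\<in>{0..2*pi}. cos t *\<^sub>R fst z + sin t *\<^sub>R snd z \<le> u) \<longrightarrow> cabs z \<le> u)"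
  unfolding cabs_def
proof (rule theI')
  obtain m where "\<forall>t\<in>{0..2*pi}. cos t *\<^sub>R fst z + sin t *\<^sub>R snd z \<le> m"
    "\<forall>u. (\<forall>t\<in>{0..2*pi}. cos t *\<^sub>R fst z + sin t *\<^sub>R snd z \<le> u) \<longrightarrow> m \<le> u"
    by (rule modulus_exists[of "fst z" "snd z"]) blast
  then show "\<exists>!m. (\<forall>t\<in>{0..2*pi}. cos t *\<^sub>R fst z + sin t *\<^sub>R snd z \<le> m) \<and>
    (\<forall>u. (\<forall>t\<in>{0..2*pi}. cos t *\<^sub>R fst z + sin t *\<^sub>R snd z \<le> u) \<longrightarrow> m \<le> u)"
    by (blast intro: order.antisym)
qed

lemma cabs_upper: "t \<in> {0..2*pi} \<Longrightarrow> cos t *\<^sub>R fst z + sin t *\<^sub>R snd z \<le> cabs z"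
  for z :: "'a \<times> 'a"
  using cabs_spec[of z] by blast

lemma cabs_least:
  "(\<And>t. t \<in> {0..2*pi} \<Longrightarrow> cos t *\<^sub>R fst z + sin t *\<^sub>R snd z \<le> u) \<Longrightarrow> cabs z \<le> u"
  for z :: "'a \<times> 'a"
  using cabs_spec[of z] by blast

text \<open>The angles 0, pi, pi/2 and 3 pi/2 give plus and minus the real and the imaginary
  part.\<close>

lemma lat_abs_le_cabs: "lat_abs (fst z) \<le> cabs z" "lat_abs (snd z) \<le> cabs z" for z :: "'a \<times> 'a"
  using cabs_upper[of 0 z] cabs_upper[of pi z] cabs_upper[of "pi / 2" z] 
    cabs_upper[of "3 / 2 * pi" z, unfolded sin_3over2_pi cos_3over2_pi]
  by (simp_all add: lat_abs_le_iff)

lemma cabs_nonneg: "0 \<le> cabs z" for z :: "'a \<times> 'a"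
  using lat_abs_nonneg lat_abs_le_cabs(1) by (rule order_trans)

lemma cabs_le: "cabs z \<le> lat_abs (fst z) + lat_abs (snd z)" for z :: "'a \<times> 'a"
proof (rule cabs_least)
  have le: "c *\<^sub>R x \<le> lat_abs x" if "\<bar>c\<bar> \<le> 1" for c and x :: 'a
  proof -
    have "c *\<^sub>R x \<le> \<bar>c\<bar> *\<^sub>R lat_abs x"
      using lat_abs_ge(1) lat_abs_scaleR_le by (rule order_trans)
    also have "\<dots> \<le> 1 *\<^sub>R lat_abs x"
      by (rule scaleR_mono_left[OF that lat_abs_nonneg])
    finally show ?thesis by simp
  qed
  show "cos t *\<^sub>R fst z + sin t *\<^sub>R snd z \<le> lat_abs (fst z) + lat_abs (snd z)" for t
    by (intro add_mono le) auto
qed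

lemma ACe_iff: "z \<in> ACe \<longleftrightarrow> fst z \<in> Ae \<and> snd z \<in> Ae" for z :: "'a \<times> 'a"
proof
  assume "z \<in> ACe"
  then obtain l where "cabs z \<le> l *\<^sub>R 1" by (auto simp: ACe_def)
  then show "fst z \<in> Ae \<and> snd z \<in> Ae"
    using lat_abs_le_cabs[of z] AeI order_trans by blast
next
  assume "fst z \<in> Ae \<and> snd z \<in> Ae"
  then obtain l m where lm: "0 \<le> l" "lat_abs (fst z) \<le> l *\<^sub>R 1" "0 \<le> m" "lat_abs (snd z) \<le> m *\<^sub>R 1"
    by (metis AeE)
  have "cabs z \<le> (l + m) *\<^sub>R 1"
    using order_trans[OF cabs_le add_mono[OF lm(2,4)]] by (simp add: scaleR_left_distrib)
  then show "z \<in> ACe"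
    using lm unfolding ACe_def by (intro CollectI exI[of _ "l + m"]) auto
qed

lemma cabs_in_Ae: "z \<in> ACe \<Longrightarrow> cabs z \<in> Ae" for z :: "'a \<times> 'a"
  unfolding ACe_def using Ae_nonnegI[OF cabs_nonneg] by blast

lemma cnorm_eq_enorm: "z \<in> ACe \<Longrightarrow> cnorm z = enorm z" for z :: "'a \<times> 'a"
  unfolding cnorm_def enorm_def
  using Ae_norm_eq_Inf[OF cabs_in_Ae, of z] by (simp add: lat_abs_of_nonneg cabs_nonneg)

section \<open>Algebra and band structure of \<open>ACe\<close>\<close>

lemma ACe_cone: "(cone :: 'a \<times> 'a) \<in> ACe"
  using Ae_one Ae_scaleR_one[of 0] by (simp add: ACe_iff cone_def)

lemma ACe_cadd: "z \<in> ACe \<Longrightarrow> w \<in> ACe \<Longrightarrow> cadd z w \<in> ACe" for z :: "'a \<times> 'a"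
  by (simp add: ACe_iff cadd_def Ae_add)

lemma ACe_cminus: "z \<in> ACe \<Longrightarrow> w \<in> ACe \<Longrightarrow> cminus z w \<in> ACe" for z :: "'a \<times> 'a"
  by (simp add: ACe_iff cminus_def Ae_diff)

lemma ACe_cscale: "z \<in> ACe \<Longrightarrow> cscale c z \<in> ACe" for z :: "'a \<times> 'a"
  by (simp add: ACe_iff cscale_def Ae_add Ae_diff Ae_scaleR)

lemma ACe_cmult: "z \<in> ACe \<Longrightarrow> w \<in> ACe \<Longrightarrow> cmult z w \<in> ACe" for z :: "'a \<times> 'a"
  by (simp add: ACe_iff cmult_def Ae_add Ae_diff Ae_mult)

text \<open>One direction tests only against \<open>cone\<close>, whose modulus dominates 1; the
  other uses that |z| is at most the sum of the moduli of its two parts.\<close>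

lemma cdisj_ACe_iff: "z \<in> cdisj ACe \<longleftrightarrow> fst z \<in> Ad \<and> snd z \<in> Ad" for z :: "'a \<times> 'a"
proof
  assume z: "z \<in> cdisj ACe"
  have "lat_abs (1::'a) \<le> cabs cone"
    using lat_abs_le_cabs(1)[of cone] by (simp add: cone_def)
  then have one_le: "1 \<le> cabs (cone :: 'a \<times> 'a)"
    by (simp add: lat_abs_of_nonneg one_nonneg)
  have disj: "inf (cabs z) (cabs (cone :: 'a \<times> 'a)) = 0"
    using z ACe_cone by (simp add: cdisj_def inf_commute)
  show "fst z \<in> Ad \<and> snd z \<in> Ad"
    unfolding Ad_def
    using disjoint_mono[OF lat_abs_nonneg lat_abs_le_cabs(1) one_nonneg one_le disj]
      disjoint_mono[OF lat_abs_nonneg lat_abs_le_cabs(2) one_nonneg one_le disj] by simp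
next
  assume z: "fst z \<in> Ad \<and> snd z \<in> Ad"
  show "z \<in> cdisj ACe"
    unfolding cdisj_def
  proof (intro CollectI ballI)
    fix w :: "'a \<times> 'a" assume "w \<in> ACe"
    then obtain l where l: "cabs w \<le> l *\<^sub>R 1" by (auto simp: ACe_def)
    have "inf (lat_abs (fst z) + lat_abs (snd z)) (cabs w) = 0"
      using z by (intro disjoint_add Ad_disjoint_Ae[OF _ cabs_nonneg l] lat_abs_nonneg cabs_nonneg) auto
    from disjoint_mono[OF cabs_nonneg cabs_le cabs_nonneg order_refl this]
    show "inf (cabs w) (cabs z) = 0"
      by (simp add: inf_commute)
  qed
qed

lemma complex_decomposition:
  fixes z :: "'a \<times> 'a"
  obtains u v where "u \<in> ACe" "v \<in> cdisj ACe" "z = cadd u v"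
proof -
  obtain b c where 1: "b \<in> Ae" "c \<in> Ad" "fst z = b + c" by (rule decomposition)
  obtain b' c' where 2: "b' \<in> Ae" "c' \<in> Ad" "snd z = b' + c'" by (rule decomposition)
  show thesis
    by (rule that[of "(b, b')" "(c, c')"])
      (use 1 2 in \<open>auto simp: ACe_iff cdisj_ACe_iff cadd_def prod_eq_iff\<close>)
qed

text \<open>In each coordinate the difference of two decompositions lies in both \<open>Ae\<close>
  and \<open>Ad\<close>.\<close>

lemma complex_decomposition_unique:
  fixes u v u' v' :: "'a \<times> 'a"
  assumes "u \<in> ACe" "v \<in> cdisj ACe" "u' \<in> ACe" "v' \<in> cdisj ACe" "cadd u v = cadd u' v'"
  shows "u = u'" "v = v'"
proof -
  have eq: "a = a' \<and> b = b'" if "a \<in> Ae" "a' \<in> Ae" "b \<in> Ad" "b' \<in> Ad" "a + b = a' + b'" for a a' b b'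
  proof -
    have "a - a' = b' - b"
      using that(5) by (simp add: algebra_simps)
    moreover have "a - a' \<in> Ae" "b' - b \<in> Ad"
      using that by (auto intro: Ae_diff Ad_diff)
    ultimately have "a - a' = 0"
      using Ae_Int_Ad by metis
    then show ?thesis using that(5) by simp
  qed
  show "u = u'" "v = v'"
    using assms eq[of "fst u" "fst u'" "fst v" "fst v'"] eq[of "snd u" "snd u'" "snd v" "snd v'"]
    by (simp_all add: ACe_iff cdisj_ACe_iff cadd_def prod_eq_iff)
qed

lemma cdisj_cmult: "b \<in> ACe \<Longrightarrow> v \<in> cdisj ACe \<Longrightarrow> cmult b v \<in> cdisj ACe" for b v :: "'a \<times> 'a"
  by (simp add: ACe_iff cdisj_ACe_iff cmult_def Ad_add Ad_diff Ad_mult_Ae)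

lemma ACe_inverse_closed:
  fixes b w :: "'a \<times> 'a"
  assumes b: "b \<in> ACe" and inv: "cmult b w = cone" "cmult w b = cone"
  shows "w \<in> ACe"
proof -
  obtain u v where uv: "u \<in> ACe" "v \<in> cdisj ACe" "w = cadd u v"
    by (rule complex_decomposition)
  have zero: "(0, 0) \<in> cdisj (ACe :: ('a \<times> 'a) set)"
    by (simp add: cdisj_ACe_iff Ad_def lat_abs_def inf_absorb1 one_nonneg)
  \<comment> \<open>Two decompositions of \<open>cone\<close> are compared: (b u) + (b v) and
    \<open>cone\<close> + 0. Uniqueness then kills b v.\<close>
  have "cadd (cmult b u) (cmult b v) = cmult b w"
    by (simp add: uv(3) cadd_def cmult_def algebra_simps)
  also have "\<dots> = cadd cone (0, 0)"
    by (simp add: inv cadd_def)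
  finally have "cmult b v = (0, 0)"
    using complex_decomposition_unique(2)[OF ACe_cmult[OF b uv(1)] cdisj_cmult[OF b uv(2)] ACe_cone zero]
    by simp
  then have "cmult w (cmult b v) = (0, 0)"
    by (simp add: cmult_def)
  moreover have "cmult w (cmult b v) = cmult (cmult w b) v"
    by (simp add: cmult_def algebra_simps)
  moreover have "cmult cone v = v"
    by (simp add: cmult_def cone_def)
  ultimately have "v = (0, 0)"
    by (simp add: inv)
  then show ?thesis
    using uv by (simp add: cadd_def)
qed

end

section \<open>Prime ideals and characters\<close>

text \<open>The positive part of an order ideal. A lattice-ordered group offers no scalars here;
  closure under nonnegative scalars follows later from sums and downward closure.\<close>

locale pos_ideal =
  fixes J :: "'a::lattice_ab_group_add set"
  assumes zero: "0 \<in> J"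
    and nonneg: "\<And>x. x \<in> J \<Longrightarrow> 0 \<le> x"
    and add: "\<And>x y. x \<in> J \<Longrightarrow> y \<in> J \<Longrightarrow> x + y \<in> J"
    and down: "\<And>x y. x \<in> J \<Longrightarrow> 0 \<le> y \<Longrightarrow> y \<le> x \<Longrightarrow> y \<in> J"

lemma pos_ideal_Union_chain:
  assumes C: "C \<noteq> {}" "subset.chain {J. pos_ideal J \<and> v \<notin> J} C"
  shows "pos_ideal (\<Union>C)"
proof -
  have ideal: "pos_ideal J" if "J \<in> C" for J
    using C(2) that by (auto simp: subset_chain_def)
  show ?thesis
  proof (rule pos_ideal.intro)
    show "0 \<in> \<Union>C"
      using C(1) pos_ideal.zero[OF ideal] by blast
  next
    fix x assume "x \<in> \<Union>C"
    then show "0 \<le> x" using pos_ideal.nonneg[OF ideal] by (elim UnionE)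
  next
    fix x y assume "x \<in> \<Union>C" "y \<in> \<Union>C"
    then obtain J J' where J: "J \<in> C" "J' \<in> C" "x \<in> J" "y \<in> J'" by blast
    then have "J \<subseteq> J' \<or> J' \<subseteq> J"
      using C(2) by (auto simp: subset_chain_def)
    then have "x \<in> J' \<or> y \<in> J"
      using J by blast
    then show "x + y \<in> \<Union>C"
      using J pos_ideal.add[OF ideal] by blast
  next
    fix x y assume "x \<in> \<Union>C" "0 \<le> y" "y \<le> x"
    then show "y \<in> \<Union>C"
      using pos_ideal.down[OF ideal] by blast
  qed
qed

context banach_lattice_algebra
begin

text \<open>The ideal generated by \<open>M\<close> and \<open>a\<close>, which is what maximality
  of \<open>M\<close> is tested against.\<close>

lemma pos_ideal_extend:
  fixes a :: 'a
  assumes M: "pos_ideal M" and a: "0 \<le> a"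
  shows "pos_ideal {x. 0 \<le> x \<and> (\<exists>j\<in>M. \<exists>c\<ge>0. x \<le> j + c *\<^sub>R a)}" (is "pos_ideal ?J")
proof (rule pos_ideal.intro)
  show "0 \<in> ?J"
    using pos_ideal.zero[OF M] a by (intro CollectI conjI bexI[of _ 0] exI[of _ 1]) auto
next
  fix x y assume "x \<in> ?J" "y \<in> ?J"
  then obtain i j c d where *: "0 \<le> x" "0 \<le> y" "i \<in> M" "j \<in> M" "0 \<le> c" "0 \<le> d"
    "x \<le> i + c *\<^sub>R a" "y \<le> j + d *\<^sub>R a"
    by auto
  have "x + y \<le> (i + j) + (c + d) *\<^sub>R a"
    using add_mono[OF *(7,8)] by (simp add: algebra_simps)
  moreover have "i + j \<in> M" "0 \<le> c + d" "0 \<le> x + y"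
    using * pos_ideal.add[OF M] by auto
  ultimately show "x + y \<in> ?J" by blast
next
  fix x y assume "x \<in> ?J" "0 \<le> y" "y \<le> x"
  then show "y \<in> ?J" by (auto intro: order_trans)
qed auto

text \<open>If disjoint \<open>a\<close> and \<open>b\<close> both lay outside a maximal
  \<open>M\<close>, then v <= i + c a and v <= j + d b with i, j in \<open>M\<close>. Hence v <= (i
  + j) + inf (c a) (d b) = i + j, which puts \<open>v\<close> into \<open>M\<close>.\<close>

lemma prime_ideal_exists:
  fixes v :: 'a
  assumes v: "0 \<le> v" "v \<noteq> 0"
  obtains J where "pos_ideal J" "v \<notin> J" "\<And>a b. inf a b = 0 \<Longrightarrow> a \<in> J \<or> b \<in> J"
proof -
  let ?A = "{J. pos_ideal J \<and> v \<notin> J}"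
  have "\<exists>M\<in>?A. \<forall>X\<in>?A. M \<subseteq> X \<longrightarrow> X = M"
  proof (rule subset_Zorn_nonempty)
    have "{0} \<in> ?A"
      using v by (auto intro!: pos_ideal.intro intro: order.antisym)
    then show "?A \<noteq> {}" by blast
  next
    fix C assume C: "C \<noteq> {}" "subset.chain ?A C"
    then show "\<Union>C \<in> ?A"
      using pos_ideal_Union_chain[OF C] by (auto simp: subset_chain_def)
  qed
  then obtain M where M: "pos_ideal M" "v \<notin> M"
    and max: "\<And>X. pos_ideal X \<Longrightarrow> v \<notin> X \<Longrightarrow> M \<subseteq> X \<Longrightarrow> X = M"
    by blast
  have absorb: "\<exists>j\<in>M. \<exists>c\<ge>0. v \<le> j + c *\<^sub>R a" if a: "0 \<le> a" "a \<notin> M" for a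
  proof (rule ccontr)
    let ?J = "{x. 0 \<le> x \<and> (\<exists>j\<in>M. \<exists>c\<ge>0. x \<le> j + c *\<^sub>R a)}"
    assume "\<not> ?thesis"
    then have "v \<notin> ?J" by blast
    moreover have "M \<subseteq> ?J"
    proof
      fix x assume "x \<in> M"
      moreover from this have "0 \<le> x"
        by (rule pos_ideal.nonneg[OF M(1)])
      moreover have "x \<le> x + 0 *\<^sub>R a" by simp
      ultimately show "x \<in> ?J" by blast
    qed
    ultimately have "?J = M"
      by (rule max[OF pos_ideal_extend[OF M(1) a(1)]])
    moreover have "a \<in> ?J"
      using a pos_ideal.zero[OF M(1)] by (intro CollectI conjI bexI[of _ 0] exI[of _ 1]) auto
    ultimately show False using a(2) by simp
  qed
  have prime: "a \<in> M \<or> b \<in> M" if ab: "inf a b = 0" for a b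
  proof (rule ccontr)
    assume "\<not> (a \<in> M \<or> b \<in> M)"
    then have notin: "a \<notin> M" "b \<notin> M" by auto
    have nn: "0 \<le> a" "0 \<le> b"
      using ab by (metis inf.cobounded1, metis inf.cobounded2)
    from absorb[OF nn(1) notin(1)] absorb[OF nn(2) notin(2)]
    obtain i j c d where *: "i \<in> M" "j \<in> M" "0 \<le> c" "0 \<le> d"
      "v \<le> i + c *\<^sub>R a" "v \<le> j + d *\<^sub>R b"
      by (elim bexE exE conjE)
    have ij: "0 \<le> i" "0 \<le> j" "i + j \<in> M"
      using * pos_ideal.nonneg[OF M(1)] pos_ideal.add[OF M(1)] by auto
    have "inf (c *\<^sub>R a) (d *\<^sub>R b) = 0"
      using ab *(3,4) by (metis disjoint_scaleR inf_commute)
    then have "inf ((i + j) + c *\<^sub>R a) ((i + j) + d *\<^sub>R b) = i + j"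
      by (simp add: add_inf_distrib_left[symmetric])
    moreover have "i + c *\<^sub>R a \<le> (i + j) + c *\<^sub>R a" "j + d *\<^sub>R b \<le> (i + j) + d *\<^sub>R b"
      using ij by simp_all
    then have "v \<le> inf ((i + j) + c *\<^sub>R a) ((i + j) + d *\<^sub>R b)"
      by (intro inf.boundedI order_trans[OF *(5)] order_trans[OF *(6)])
    ultimately have "v \<le> i + j"
      by simp
    then show False
      using M(2) pos_ideal.down[OF M(1) ij(3) v(1)] by blast
  qed
  show thesis
    using that M prime by blast
qed

text \<open>Unital positive multiplicative functionals on \<open>Ae\<close>, set to zero elsewhere:
  a character is then determined by its values on \<open>Ae\<close>, and the whole set sits in a
  product of real lines.\<close>

definition characters :: "('a \<Rightarrow> real) set" where
  "characters = {k. (\<forall>x\<in>Ae. \<forall>y\<in>Ae. k (x + y) = k x + k y) \<and> (\<forall>c. \<forall>x\<in>Ae. k (c *\<^sub>R x) = c * k x)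
    \<and> (\<forall>x\<in>Ae. \<forall>y\<in>Ae. k (x * y) = k x * k y) \<and> k 1 = 1 \<and> (\<forall>x\<in>Ae. 0 \<le> x \<longrightarrow> 0 \<le> k x)
    \<and> (\<forall>x. x \<notin> Ae \<longrightarrow> k x = 0)}"

end

text \<open>The quotient by a prime ideal is totally ordered; the character it induces assigns to \<open>x\<close> the
  infimum of the scalars dominating \<open>x\<close> modulo the ideal.\<close>

locale prime_pos_ideal = banach_lattice_algebra type + pos_ideal J
  for type :: "'a::{real_normed_algebra_1, banach, lattice_ab_group_add} itself" and J :: "'a set" +
  assumes prime: "\<And>a b. inf a b = 0 \<Longrightarrow> a \<in> J \<or> b \<in> J"
    and proper: "1 \<notin> J"
begin

section \<open>The character induced by a prime ideal\<close>

lemma J_scaleR: "x \<in> J \<Longrightarrow> 0 \<le> c \<Longrightarrow> c *\<^sub>R x \<in> J"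
proof -
  assume x: "x \<in> J" and c: "0 \<le> c"
  have nat: "real n *\<^sub>R x \<in> J" for n
    by (induction n) (auto simp: zero add x scaleR_left_distrib)
  obtain n :: nat where "c \<le> real n" by (rule real_arch_simple[THEN exE])
  then show ?thesis
    using down[OF nat[of n]] nonneg[OF x] c scaleR_nonneg scaleR_mono_left by blast
qed

lemma not_J: "0 < l \<Longrightarrow> l *\<^sub>R 1 \<le> x \<Longrightarrow> x \<notin> J"
proof
  assume l: "0 < l" "l *\<^sub>R 1 \<le> x" and "x \<in> J"
  then have "l *\<^sub>R 1 \<in> J"
    using down scaleR_nonneg one_nonneg less_imp_le by blast
  from J_scaleR[OF this, of "1 / l"] l(1) proper show False by simp
qed

definition char :: "'a \<Rightarrow> real" where
  "char x = (if x \<in> Ae then Inf {l. pprt (x - l *\<^sub>R 1) \<in> J} else 0)"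

text \<open>Makes the infimum in \<open>char\<close> meaningful. For l < - norm x, the element x - l
  1 exceeds a positive multiple of 1, which no member of \<open>J\<close> does.\<close>

lemma char_set_bounds:
  assumes "x \<in> Ae"
  shows "norm x \<in> {l. pprt (x - l *\<^sub>R 1) \<in> J}" "bdd_below {l. pprt (x - l *\<^sub>R 1) \<in> J}"
proof -
  have le: "x \<le> norm x *\<^sub>R 1" "- x \<le> norm x *\<^sub>R 1"
    using Ae_le_norm[OF assms] by (simp_all add: lat_abs_le_iff)
  show "norm x \<in> {l. pprt (x - l *\<^sub>R 1) \<in> J}"
    using le(1) by (simp add: zero)
  show "bdd_below {l. pprt (x - l *\<^sub>R 1) \<in> J}"
  proof (rule bdd_belowI)
    fix l assume l: "l \<in> {l. pprt (x - l *\<^sub>R 1) \<in> J}"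
    show "- norm x \<le> l"
    proof (rule ccontr)
      assume "\<not> - norm x \<le> l"
      then have "0 < - norm x - l" by simp
      moreover have "(- norm x - l) *\<^sub>R 1 \<le> pprt (x - l *\<^sub>R 1)"
        using le(2) unfolding pprt_def
        by (intro le_supI1) (simp add: scaleR_left_diff_distrib minus_le_iff)
      ultimately show False using not_J l by blast
    qed
  qed
qed

lemma char_le: "x \<in> Ae \<Longrightarrow> pprt (x - l *\<^sub>R 1) \<in> J \<Longrightarrow> char x \<le> l"
  unfolding char_def using cInf_lower[OF _ char_set_bounds(2), of l] by simp

text \<open>The inequality is strict because the infimum need not be attained; above it, membership
  follows since the set of scalars is upward closed.\<close>

lemma char_less: "x \<in> Ae \<Longrightarrow> char x < l \<Longrightarrow> pprt (x - l *\<^sub>R 1) \<in> J"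
proof -
  assume x: "x \<in> Ae" and "char x < l"
  then have "Inf {l. pprt (x - l *\<^sub>R 1) \<in> J} < l" by (simp add: char_def)
  then obtain m where m: "m < l" "pprt (x - m *\<^sub>R 1) \<in> J"
    using cInf_lessD char_set_bounds(1)[OF x] by (metis (mono_tags, lifting) empty_iff mem_Collect_eq)
  have "pprt (x - l *\<^sub>R 1) \<le> pprt (x - m *\<^sub>R 1)"
    using m(1) by (intro pprt_mono diff_left_mono scaleR_mono_left one_nonneg) simp
  then show ?thesis
    by (rule down[OF m(2), rotated]) simp
qed

lemma char_nonneg: "x \<in> Ae \<Longrightarrow> 0 \<le> x \<Longrightarrow> 0 \<le> char x"
proof (rule ccontr)
  assume x: "x \<in> Ae" "0 \<le> x" and "\<not> 0 \<le> char x"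
  then have neg: "char x < 0" by simp
  \<comment> \<open>Half of the supposedly negative value lies strictly between it and 0.\<close>
  have "(- (char x / 2)) *\<^sub>R 1 \<le> pprt (x - (char x / 2) *\<^sub>R 1)"
    using x(2) unfolding pprt_def by (intro le_supI1) simp
  then show False
    using char_less[OF x(1), of "char x / 2"] not_J[of "- (char x / 2)"] neg by auto
qed

lemma char_subadditive: "x \<in> Ae \<Longrightarrow> y \<in> Ae \<Longrightarrow> char (x + y) \<le> char x + char y"
proof (rule field_le_epsilon)
  fix e :: real
  assume x: "x \<in> Ae" and y: "y \<in> Ae" and e: "0 < e"
  define l m where "l = char x + e / 2" and "m = char y + e / 2"
  have "pprt (x - l *\<^sub>R 1) \<in> J" "pprt (y - m *\<^sub>R 1) \<in> J"
    using e by (auto intro!: char_less x y simp: l_def m_def)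
  then have "pprt (x - l *\<^sub>R 1) + pprt (y - m *\<^sub>R 1) \<in> J" by (rule add)
  moreover have "pprt ((x + y) - (l + m) *\<^sub>R 1) \<le> pprt (x - l *\<^sub>R 1) + pprt (y - m *\<^sub>R 1)"
    using pprt_subadditive[of "x - l *\<^sub>R 1" "y - m *\<^sub>R 1"] by (simp add: algebra_simps)
  ultimately have "pprt ((x + y) - (l + m) *\<^sub>R 1) \<in> J"
    using down zero_le_pprt by blast
  then have "char (x + y) \<le> l + m"
    by (rule char_le[OF Ae_add[OF x y]])
  then show "char (x + y) \<le> char x + char y + e"
    by (simp add: l_def m_def)
qed

lemma char_zero: "char 0 = 0"
  using char_le[of 0 0] char_nonneg[of 0] Ae_scaleR_one[of 0] by (simp add: zero)

text \<open>Primeness enters here: a scalar that fails to dominate \<open>x\<close> modulo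
  \<open>J\<close> is dominated by \<open>x\<close>. This turns subadditivity into
  additivity.\<close>

lemma char_minus: "x \<in> Ae \<Longrightarrow> char (- x) = - char x"
proof (rule antisym)
  assume x: "x \<in> Ae"
  show "char (- x) \<le> - char x"
  proof (rule field_le_epsilon)
    fix e :: real assume e: "0 < e"
    then have "pprt (x - (char x - e) *\<^sub>R 1) \<notin> J"
      using char_le[OF x, of "char x - e"] by auto
    then have "pprt (- (x - (char x - e) *\<^sub>R 1)) \<in> J"
      using prime[OF pprt_inf_pprt_minus] by blast
    also have "- (x - (char x - e) *\<^sub>R 1) = - x - (- char x + e) *\<^sub>R 1"
      by (simp add: algebra_simps)
    finally show "char (- x) \<le> - char x + e"
      by (rule char_le[OF Ae_minus[OF x]])
  qed
  show "- char x \<le> char (- x)"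
    using char_subadditive[OF x Ae_minus[OF x]] by (simp add: char_zero)
qed

lemma char_add: "x \<in> Ae \<Longrightarrow> y \<in> Ae \<Longrightarrow> char (x + y) = char x + char y"
  using char_subadditive[of x y] char_subadditive[of "x + y" "- y"]
  by (simp add: char_minus Ae_add Ae_minus)

lemma char_diff: "x \<in> Ae \<Longrightarrow> y \<in> Ae \<Longrightarrow> char (x - y) = char x - char y"
  using char_add[of x "- y"] by (simp add: char_minus Ae_minus)

lemma char_mono: "x \<in> Ae \<Longrightarrow> y \<in> Ae \<Longrightarrow> x \<le> y \<Longrightarrow> char x \<le> char y"
  using char_nonneg[of "y - x"] by (simp add: char_diff Ae_diff)

lemma char_scaleR_pos_le: "x \<in> Ae \<Longrightarrow> 0 < c \<Longrightarrow> char (c *\<^sub>R x) \<le> c * char x"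
proof (rule field_le_epsilon)
  fix e :: real
  assume x: "x \<in> Ae" and c: "0 < c" and e: "0 < e"
  have "pprt (x - (char x + e / c) *\<^sub>R 1) \<in> J"
    using c e by (intro char_less x) simp
  then have "c *\<^sub>R pprt (x - (char x + e / c) *\<^sub>R 1) \<in> J"
    using c by (intro J_scaleR) auto
  also have "c *\<^sub>R pprt (x - (char x + e / c) *\<^sub>R 1) = pprt (c *\<^sub>R x - (c * char x + e) *\<^sub>R 1)"
    using c by (simp add: pprt_scaleR[symmetric] algebra_simps)
  finally show "char (c *\<^sub>R x) \<le> c * char x + e"
    by (rule char_le[OF Ae_scaleR[OF x]])
qed

lemma char_scaleR: "x \<in> Ae \<Longrightarrow> char (c *\<^sub>R x) = c * char x"
proof -
  assume x: "x \<in> Ae"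
  \<comment> \<open>The missing inequality is the known one for \<open>- x\<close>.\<close>
  have pos: "char (c *\<^sub>R x) = c * char x" if c: "0 < c" for c
    using char_scaleR_pos_le[OF x c] char_scaleR_pos_le[OF Ae_minus[OF x] c]
    by (simp add: char_minus x Ae_scaleR)
  consider "0 < c" | "c = 0" | "0 < - c" by linarith
  then show ?thesis
  proof cases
    case 3
    then show ?thesis
      using pos[OF 3] char_minus[OF Ae_scaleR[OF x, of c]] by simp
  qed (simp_all add: pos char_zero)
qed

lemma char_one: "char 1 = 1"
  using char_le[OF Ae_one, of 1] char_le[OF Ae_minus[OF Ae_one], of "- 1"]
  by (simp add: zero char_minus Ae_one)

text \<open>The kernel is closed under moduli, because the positive part of |x| - e 1 is at most the
  sum of the positive parts of x - e 1 and - x - e 1.\<close>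

lemma char_lat_abs_eq_0: "x \<in> Ae \<Longrightarrow> char x = 0 \<Longrightarrow> char (lat_abs x) = 0"
proof (rule antisym)
  assume x: "x \<in> Ae" and 0: "char x = 0"
  show "char (lat_abs x) \<le> 0"
  proof (rule field_le_epsilon)
    fix e :: real assume e: "0 < e"
    have "pprt (x - e *\<^sub>R 1) \<in> J" "pprt (- x - e *\<^sub>R 1) \<in> J"
      using e 0 by (auto intro!: char_less x Ae_minus simp: char_minus x)
    then have sum: "pprt (x - e *\<^sub>R 1) + pprt (- x - e *\<^sub>R 1) \<in> J" by (rule add)
    have le: "x - e *\<^sub>R 1 \<le> pprt (x - e *\<^sub>R 1) + pprt (- x - e *\<^sub>R 1)"
      "- x - e *\<^sub>R 1 \<le> pprt (x - e *\<^sub>R 1) + pprt (- x - e *\<^sub>R 1)"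
      by (rule add_increasing2, simp, simp add: pprt_def) (rule add_increasing, simp, simp add: pprt_def)
    have "lat_abs x \<le> pprt (x - e *\<^sub>R 1) + pprt (- x - e *\<^sub>R 1) + e *\<^sub>R 1"
      unfolding lat_abs_le_iff using le by (simp add: diff_le_eq)
    then have "pprt (lat_abs x - e *\<^sub>R 1) \<le> pprt (x - e *\<^sub>R 1) + pprt (- x - e *\<^sub>R 1)"
      unfolding pprt_def[of "lat_abs x - e *\<^sub>R 1"] by (simp add: diff_le_eq add_nonneg_nonneg)
    then have "pprt (lat_abs x - e *\<^sub>R 1) \<in> J"
      by (rule down[OF sum, rotated]) simp
    then show "char (lat_abs x) \<le> 0 + e"
      using char_le[OF Ae_lat_abs[OF x]] by simp
  qed
  show "0 \<le> char (lat_abs x)"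
    by (rule char_nonneg[OF Ae_lat_abs[OF x] lat_abs_nonneg])
qed

text \<open>Subtracting a scalar from \<open>x\<close> reduces the claim to \<open>z\<close> in the
  kernel. There |z y| <= m |z|, and |z| is in the kernel as well.\<close>

lemma char_mult: "x \<in> Ae \<Longrightarrow> y \<in> Ae \<Longrightarrow> char (x * y) = char x * char y"
proof -
  assume x: "x \<in> Ae" and y: "y \<in> Ae"
  define z where "z = x - char x *\<^sub>R 1"
  have z: "z \<in> Ae" by (simp add: z_def Ae_diff x Ae_scaleR_one)
  have "char z = 0"
    by (simp add: z_def char_diff x Ae_scaleR_one char_scaleR Ae_one char_one)
  then have abs0: "char (lat_abs z) = 0" by (rule char_lat_abs_eq_0[OF z])
  obtain m where m: "lat_abs y \<le> m *\<^sub>R 1" using y by (rule AeE)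
  have zy: "z * y \<in> Ae" and mz: "m *\<^sub>R lat_abs z \<in> Ae"
    by (simp_all add: Ae_mult Ae_scaleR Ae_lat_abs z y)
  have "z * y \<le> m *\<^sub>R lat_abs z" "- (z * y) \<le> m *\<^sub>R lat_abs z"
    using lat_abs_mult_Ae_le(2)[OF m, of z] by (simp_all add: lat_abs_le_iff)
  then have "char (z * y) \<le> 0" "char (- (z * y)) \<le> 0"
    using char_mono[OF zy mz] char_mono[OF Ae_minus[OF zy] mz]
    by (simp_all add: char_scaleR Ae_lat_abs z abs0)
  then have "char (z * y) = 0"
    by (simp add: char_minus zy)
  moreover have "x * y = z * y + char x *\<^sub>R y"
    by (simp add: z_def left_diff_distrib)
  ultimately show ?thesis
    by (simp add: char_add zy Ae_scaleR y char_scaleR)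
qed

lemma char_in_characters: "char \<in> characters"
proof -
  have "char x = 0" if "x \<notin> Ae" for x
    using that by (simp add: char_def)
  then show ?thesis
    by (simp add: characters_def char_add char_scaleR char_mult char_one char_nonneg)
qed

end

context banach_lattice_algebra
begin

text \<open>By the Archimedean property - x exceeds e 1 somewhere for some e > 0. A prime ideal
  avoiding the excess \<open>v\<close> has a character whose value at - x is at least e.\<close>

lemma characters_separate:
  fixes x :: 'a
  assumes x: "x \<in> Ae" and neg: "\<not> 0 \<le> x"
  obtains k where "k \<in> characters" "k x < 0"
proof -
  obtain e where e: "0 < e" "\<not> - x \<le> e *\<^sub>R 1"
    using le_scaleR_limit[OF one_nonneg, of 0 "- x"] neg by auto
  define v where "v = pprt (- x - e *\<^sub>R 1)"
  have v: "v \<in> Ae" "0 \<le> v"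
    by (simp_all add: v_def Ae_pprt Ae_diff Ae_minus x Ae_scaleR_one)
  have "v \<noteq> 0"
    using e(2) le_zero_iff_zero_pprt[of "- x - e *\<^sub>R 1"] by (simp add: v_def)
  then obtain J where J: "pos_ideal J" "v \<notin> J" "\<And>a b. inf a b = 0 \<Longrightarrow> a \<in> J \<or> b \<in> J"
    using prime_ideal_exists v(2) by blast
  obtain l where l: "0 \<le> l" "lat_abs v \<le> l *\<^sub>R 1" using v(1) by (rule AeE)
  \<comment> \<open>\<open>v\<close> lies below a multiple of 1, so an ideal containing 1 would
    contain \<open>v\<close>.\<close>
  have "1 \<notin> J"
  proof
    assume 1: "1 \<in> J"
    have nat: "real n *\<^sub>R 1 \<in> J" for n
      by (induction n) (auto simp: scaleR_left_distrib 1 pos_ideal.zero[OF J(1)] pos_ideal.add[OF J(1)])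
    obtain n :: nat where n: "l \<le> real n" by (rule real_arch_simple[THEN exE])
    have "v \<le> real n *\<^sub>R 1"
      using l(2) scaleR_mono_left[OF n one_nonneg] by (simp add: lat_abs_of_nonneg v(2))
    then show False
      using J(2) pos_ideal.down[OF J(1) nat[of n] v(2)] by blast
  qed
  interpret pos_ideal J by (rule J(1))
  interpret prime_pos_ideal type J
    by unfold_locales (rule J(3), assumption, rule \<open>1 \<notin> J\<close>)
  have "e \<le> char (- x)"
    using char_less[OF Ae_minus[OF x], of e] J(2) unfolding v_def by (meson not_le)
  then have "char x < 0"
    using e(1) by (simp add: char_minus x)
  then show thesis
    using that char_in_characters by blast
qed

end

section \<open>Separation axioms for pointwise convergence\<close>

lemma open_evaluation_vimage: "open U \<Longrightarrow> open ((\<lambda>h. h x) -` U)"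
  for U :: "'b::topological_space set"
  by (intro open_vimage) simp_all

text \<open>The Stone-Weierstrass locale \<open>function_ring_on\<close> is stated over a
  \<open>t2_space\<close> type, and characters are points of a function type. Here and in the next
  two instances the separating sets are pulled back along a coordinate where the functions
  differ.\<close>

instance "fun" :: (type, t0_space) t0_space
proof
  fix f g :: "'a \<Rightarrow> 'b" assume "f \<noteq> g"
  then obtain x where "f x \<noteq> g x" by (auto simp: fun_eq_iff)
  from separation_t0[THEN iffD1, OF this] obtain U where "open U" "\<not> (f x \<in> U \<longleftrightarrow> g x \<in> U)"
    by blast
  then show "\<exists>U. open U \<and> \<not> (f \<in> U \<longleftrightarrow> g \<in> U)"
    by (intro exI[of _ "(\<lambda>h. h x) -` U"]) (simp add: open_evaluation_vimage)
qed

instance "fun" :: (type, t1_space) t1_space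
proof
  fix f g :: "'a \<Rightarrow> 'b" assume "f \<noteq> g"
  then obtain x where "f x \<noteq> g x" by (auto simp: fun_eq_iff)
  from separation_t1[THEN iffD1, OF this] obtain U where "open U" "f x \<in> U" "g x \<notin> U"
    by blast
  then show "\<exists>U. open U \<and> f \<in> U \<and> g \<notin> U"
    by (intro exI[of _ "(\<lambda>h. h x) -` U"]) (simp add: open_evaluation_vimage)
qed

instance "fun" :: (type, t2_space) t2_space
proof
  fix f g :: "'a \<Rightarrow> 'b" assume "f \<noteq> g"
  then obtain x where "f x \<noteq> g x" by (auto simp: fun_eq_iff)
  from hausdorff[OF this] obtain U V where "open U" "open V" "f x \<in> U" "g x \<in> V" "U \<inter> V = {}"
    by blast
  then show "\<exists>U V. open U \<and> open V \<and> f \<in> U \<and> g \<in> V \<and> U \<inter> V = {}"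
    by (intro exI[of _ "(\<lambda>h. h x) -` U"] exI[of _ "(\<lambda>h. h x) -` V"])
      (auto simp: open_evaluation_vimage)
qed

context banach_lattice_algebra
begin

section \<open>The representation on the character space\<close>

context
  fixes k :: "'a \<Rightarrow> real"
  assumes k: "k \<in> characters"
begin

lemma character_add: "x \<in> Ae \<Longrightarrow> y \<in> Ae \<Longrightarrow> k (x + y) = k x + k y"
  and character_scaleR: "x \<in> Ae \<Longrightarrow> k (c *\<^sub>R x) = c * k x"
  and character_mult: "x \<in> Ae \<Longrightarrow> y \<in> Ae \<Longrightarrow> k (x * y) = k x * k y"
  and character_one: "k 1 = 1"
  and character_nonneg: "x \<in> Ae \<Longrightarrow> 0 \<le> x \<Longrightarrow> 0 \<le> k x"
  and character_outside: "x \<notin> Ae \<Longrightarrow> k x = 0"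
  using k by (simp_all add: characters_def)

lemma character_zero: "k 0 = 0"
  using character_scaleR[OF Ae_one, of 0] by simp

lemma character_diff: "x \<in> Ae \<Longrightarrow> y \<in> Ae \<Longrightarrow> k (x - y) = k x - k y"
  using character_add[of "x - y" y] by (simp add: Ae_diff)

lemma character_mono: "x \<in> Ae \<Longrightarrow> y \<in> Ae \<Longrightarrow> x \<le> y \<Longrightarrow> k x \<le> k y"
  using character_nonneg[of "y - x"] by (simp add: character_diff Ae_diff)

lemma character_le_norm: "\<bar>k x\<bar> \<le> norm x"
proof (cases "x \<in> Ae")
  case True
  have le: "x \<le> norm x *\<^sub>R 1" "- x \<le> norm x *\<^sub>R 1"
    using Ae_le_norm[OF True] by (simp_all add: lat_abs_le_iff)
  have "k x \<le> norm x" "k (- x) \<le> norm x"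
    using character_mono[OF True Ae_scaleR_one le(1)] character_mono[OF Ae_minus[OF True] Ae_scaleR_one le(2)]
    by (simp_all add: character_scaleR Ae_one character_one)
  then show ?thesis
    using character_scaleR[OF True, of "-1"] by simp
qed (simp add: character_outside)

end

text \<open>Tychonoff: the characters form a closed subset of the product of the intervals
  [- norm x, norm x], each defining condition being closed under pointwise convergence.\<close>

lemma compact_characters: "compact characters"
proof -
  let ?B = "Pi\<^sub>E UNIV (\<lambda>x::'a. {- norm x .. norm x})"
  have "compactin (product_topology (\<lambda>i. euclidean) UNIV) ?B"
    by (subst compactin_PiE) simp
  then have "compact ?B"
    by (simp add: euclidean_product_topology)
  moreover have "closed characters"
    unfolding characters_def Ball_def
    by (intro closed_Collect_conj closed_Collect_all closed_Collect_imp open_Collect_const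
        closed_Collect_eq closed_Collect_le continuous_intros) auto
  moreover have "characters \<subseteq> ?B"
  proof
    fix k assume "k \<in> characters"
    then have "- norm x \<le> k x \<and> k x \<le> norm x" for x
      using character_le_norm[of k x] by linarith
    then show "k \<in> ?B"
      by (simp add: PiE_iff)
  qed
  ultimately show ?thesis
    using compact_Int_closed[of ?B characters] by (simp add: Int_absorb1)
qed

lemma continuous_on_evaluation: "continuous_on S (\<lambda>k. k (x :: 'a) :: real)"
  by (rule continuous_on_subset[OF continuous_on_product_coordinates]) simp

lemma Ae_nonneg_iff:
  fixes x :: 'a
  assumes "x \<in> Ae"
  shows "0 \<le> x \<longleftrightarrow> (\<forall>k\<in>characters. 0 \<le> k x)"
proof
  assume "0 \<le> x"
  then show "\<forall>k\<in>characters. 0 \<le> k x"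
    using character_nonneg assms by simp
next
  assume nn: "\<forall>k\<in>characters. 0 \<le> k x"
  show "0 \<le> x"
  proof (rule ccontr)
    assume "\<not> 0 \<le> x"
    with assms obtain k where "k \<in> characters" "k x < 0"
      by (rule characters_separate)
    then show False
      using bspec[OF nn, of k] by simp
  qed
qed

lemma Ae_le_iff:
  fixes x y :: 'a
  assumes "x \<in> Ae" "y \<in> Ae"
  shows "x \<le> y \<longleftrightarrow> (\<forall>k\<in>characters. k x \<le> k y)"
  using Ae_nonneg_iff[OF Ae_diff[OF assms(2,1)]] assms by (simp add: character_diff)

lemma Ae_eqI:
  fixes x y :: 'a
  assumes "x \<in> Ae" "y \<in> Ae" "\<And>k. k \<in> characters \<Longrightarrow> k x = k y"
  shows "x = y"
proof (rule order.antisym)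
  show "x \<le> y"
    unfolding Ae_le_iff[OF assms(1,2)] by (simp add: assms(3))
  show "y \<le> x"
    unfolding Ae_le_iff[OF assms(2,1)] by (simp add: assms(3))
qed

text \<open>Without characters the pointwise criterion would hold vacuously for - 1.\<close>

lemma characters_nonempty: "characters \<noteq> {}"
  using Ae_nonneg_iff[OF Ae_minus[OF Ae_one]] one_nonneg by auto

lemma Ae_norm_leI:
  fixes x :: 'a
  assumes x: "x \<in> Ae" and le: "\<And>k. k \<in> characters \<Longrightarrow> \<bar>k x\<bar> \<le> c"
  shows "norm x \<le> c"
proof -
  obtain k where "k \<in> characters"
    using characters_nonempty by blast
  then have c: "0 \<le> c" using le by fastforce
  have "k (- x) = - k x" if "k \<in> characters" for k
    using character_scaleR[OF that x, of "-1"] by simp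
  then have "x \<le> c *\<^sub>R 1" "- x \<le> c *\<^sub>R 1"
    using le by (auto simp: Ae_le_iff x Ae_minus Ae_scaleR_one character_scaleR Ae_one character_one abs_le_iff)
  then show ?thesis
    using Ae_norm_le_iff[OF x c] by (simp add: lat_abs_le_iff)
qed

lemma evaluation_dense:
  assumes f: "continuous_on characters f" and e: "0 < e"
  shows "\<exists>x\<in>Ae. \<forall>k\<in>characters. \<bar>f k - k (x :: 'a)\<bar> < e"
proof -
  \<comment> \<open>Agreement is required on \<open>characters\<close> only, since sums and products
    of evaluations are evaluations only there.\<close>
  define R where "R = {f. \<exists>x\<in>Ae. \<forall>k\<in>characters. f k = k (x :: 'a)}"
  have RI: "f \<in> R" if "x \<in> Ae" "\<And>k. k \<in> characters \<Longrightarrow> f k = k x" for f x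
    using that by (auto simp: R_def)
  interpret function_ring_on R characters
  proof
    show "continuous_on characters f" if f: "f \<in> R" for f
    proof -
      obtain x where x: "\<forall>k\<in>characters. f k = k x"
        using f unfolding R_def by blast
      have "continuous_on characters f \<longleftrightarrow> continuous_on characters (\<lambda>k. k x)"
        by (rule continuous_on_cong) (simp_all add: x)
      then show ?thesis
        by (simp add: continuous_on_evaluation)
    qed
  next
    fix f g assume "f \<in> R" "g \<in> R"
    then obtain x y where xy: "x \<in> Ae" "y \<in> Ae" "\<forall>k\<in>characters. f k = k x"
      "\<forall>k\<in>characters. g k = k y"
      unfolding R_def by blast
    show "(\<lambda>k. f k + g k) \<in> R"
      by (rule RI[of "x + y"]) (simp_all add: xy Ae_add character_add)
    show "(\<lambda>k. f k * g k) \<in> R"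
      by (rule RI[of "x * y"]) (simp_all add: xy Ae_mult character_mult)
  next
    show "(\<lambda>_. c) \<in> R" for c
      by (rule RI[of "c *\<^sub>R 1"]) (simp_all add: Ae_scaleR_one character_scaleR Ae_one character_one)
  next
    fix k k' assume k: "k \<in> characters" "k' \<in> characters" "k \<noteq> k'"
    then obtain x where x: "k x \<noteq> k' x" by auto
    \<comment> \<open>Two characters both vanish outside \<open>Ae\<close>, so a point where they
      differ lies in \<open>Ae\<close>.\<close>
    then have "x \<in> Ae"
      using character_outside k by metis
    then show "\<exists>f\<in>R. f k \<noteq> f k'"
      using x by (intro bexI[of _ "\<lambda>k. k x"] RI) auto
  qed (rule compact_characters)
  obtain g where g: "g \<in> R" "\<forall>k\<in>characters. \<bar>f k - g k\<bar> < e"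
    using Stone_Weierstrass_basic[OF f e] by blast
  then obtain x where x: "x \<in> Ae" "\<forall>k\<in>characters. g k = k x"
    unfolding R_def by blast
  show ?thesis
    using g(2) x(2) by (intro bexI[OF _ x(1)]) simp
qed

text \<open>Uniform approximants come from a norm Cauchy sequence, because on \<open>Ae\<close> a
  uniform bound on character values bounds the norm. The limit stays in \<open>Ae\<close>, which is
  closed.\<close>

lemma evaluation_surj:
  assumes f: "continuous_on characters f"
  shows "\<exists>x\<in>Ae. \<forall>k\<in>characters. k (x :: 'a) = f k"
proof -
  define d where "d n = 1 / real (Suc n)" for n
  have d0: "d \<longlonglongrightarrow> 0"
    unfolding d_def[abs_def] by (rule LIMSEQ_Suc[OF lim_1_over_n])
  have "\<exists>x\<in>Ae. \<forall>k\<in>characters. \<bar>f k - k x\<bar> < d n" for n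
    by (rule evaluation_dense[OF f]) (simp add: d_def)
  then obtain g where g: "\<And>n. g n \<in> Ae" "\<And>n k. k \<in> characters \<Longrightarrow> \<bar>f k - k (g n)\<bar> < d n"
    by metis
  have dist: "norm (g m - g n) \<le> d m + d n" for m n
  proof (rule Ae_norm_leI)
    fix k assume "k \<in> characters"
    then show "\<bar>k (g m - g n)\<bar> \<le> d m + d n"
      using g(2)[of k m] g(2)[of k n] by (simp add: character_diff g(1))
  qed (simp add: Ae_diff g)
  have "Cauchy g"
    unfolding Cauchy_iff
  proof (intro allI impI)
    fix e :: real assume e: "0 < e"
    then have "eventually (\<lambda>n. d n < e / 2) sequentially"
      using d0 by (intro order_tendstoD) auto
    then obtain N where N: "\<And>n. N \<le> n \<Longrightarrow> d n < e / 2"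
      by (auto simp: eventually_sequentially)
    have "norm (g m - g n) < e" if "N \<le> m" "N \<le> n" for m n
      using dist[of m n] N[OF that(1)] N[OF that(2)] by simp
    then show "\<exists>M. \<forall>m\<ge>M. \<forall>n\<ge>M. norm (g m - g n) < e" by blast
  qed
  then obtain x where x: "g \<longlonglongrightarrow> x"
    using Cauchy_convergent convergent_def by blast
  have xA: "x \<in> Ae"
    by (rule closed_sequentially[OF closed_Ae _ x]) (simp add: g)
  have "k x = f k" if k: "k \<in> characters" for k
  proof -
    have "(\<lambda>n. k (g n)) \<longlonglongrightarrow> f k"
    proof (rule LIM_zero_cancel, rule Lim_null_comparison[OF _ d0])
      show "\<forall>\<^sub>F n in sequentially. norm (k (g n) - f k) \<le> d n"
        using g(2)[OF k] by (auto intro!: always_eventually less_imp_le simp: abs_minus_commute)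
    qed
    moreover have "(\<lambda>n. k (g n)) \<longlonglongrightarrow> k x"
    proof (rule LIM_zero_cancel, rule Lim_null_comparison)
      show "\<forall>\<^sub>F n in sequentially. norm (k (g n) - k x) \<le> norm (g n - x)"
        using character_le_norm[OF k] by (auto intro!: always_eventually simp: character_diff[OF k g(1) xA, symmetric])
      show "(\<lambda>n. norm (g n - x)) \<longlonglongrightarrow> 0"
        using x by (simp add: LIM_zero_iff tendsto_norm_zero_iff)
    qed
    ultimately show ?thesis
      by (rule LIMSEQ_unique[OF _ _, symmetric])
  qed
  then show ?thesis
    using xA by (intro bexI[of _ x]) simp_all
qed

section \<open>The transform on the complexification, its modulus and the spectrum\<close>

definition gelfand :: "'a \<times> 'a \<Rightarrow> ('a \<Rightarrow> real) \<Rightarrow> complex" where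
  "gelfand z k = Complex (k (fst z)) (k (snd z))"

lemma gelfand_real: "k \<in> characters \<Longrightarrow> gelfand (x, 0) k = of_real (k x)"
  by (simp add: gelfand_def character_zero complex_of_real_def)

lemma continuous_on_gelfand: "continuous_on S (gelfand z)"
  unfolding gelfand_def[abs_def] Complex_eq
  by (intro continuous_intros continuous_on_evaluation)

lemma gelfand_surj:
  assumes "continuous_on characters f"
  shows "\<exists>z\<in>ACe. \<forall>k\<in>characters. gelfand z k = f k"
proof -
  have "continuous_on characters (\<lambda>k. Re (f k))" "continuous_on characters (\<lambda>k. Im (f k))"
    by (intro continuous_intros assms)+
  from this[THEN evaluation_surj] obtain x y where
    "x \<in> Ae" "\<forall>k\<in>characters. k x = Re (f k)" "y \<in> Ae" "\<forall>k\<in>characters. k y = Im (f k)"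
    by blast
  then show ?thesis
    by (intro bexI[of _ "(x, y)"]) (simp_all add: ACe_iff gelfand_def complex_eq_iff)
qed

lemma gelfand_inj:
  assumes "z \<in> ACe" "w \<in> ACe" "\<And>k. k \<in> characters \<Longrightarrow> gelfand z k = gelfand w k"
  shows "z = w"
  using assms by (auto simp: prod_eq_iff ACe_iff gelfand_def intro: Ae_eqI)

lemma gelfand_cadd:
  "k \<in> characters \<Longrightarrow> z \<in> ACe \<Longrightarrow> w \<in> ACe \<Longrightarrow> gelfand (cadd z w) k = gelfand z k + gelfand w k"
  by (simp add: gelfand_def cadd_def ACe_iff character_add complex_eq_iff)

lemma gelfand_cminus:
  "k \<in> characters \<Longrightarrow> z \<in> ACe \<Longrightarrow> w \<in> ACe \<Longrightarrow> gelfand (cminus z w) k = gelfand z k - gelfand w k"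
  by (simp add: gelfand_def cminus_def ACe_iff character_diff complex_eq_iff)

lemma gelfand_cscale:
  "k \<in> characters \<Longrightarrow> z \<in> ACe \<Longrightarrow> gelfand (cscale c z) k = c * gelfand z k"
  by (simp add: gelfand_def cscale_def ACe_iff character_add character_diff character_scaleR
      Ae_scaleR complex_eq_iff)

lemma gelfand_cmult:
  "k \<in> characters \<Longrightarrow> z \<in> ACe \<Longrightarrow> w \<in> ACe \<Longrightarrow> gelfand (cmult z w) k = gelfand z k * gelfand w k"
  by (simp add: gelfand_def cmult_def ACe_iff character_add character_diff character_mult
      Ae_mult complex_eq_iff)

lemma gelfand_cone: "k \<in> characters \<Longrightarrow> gelfand cone k = 1"
  by (simp add: gelfand_def cone_def character_one character_zero complex_eq_iff)

text \<open>By surjectivity some element of the ideal has transform \<open>\<bar>gelfand z\<bar>\<close>; as the order is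
  pointwise on characters, it is an upper bound of all \<open>x cos t + y sin t\<close>.\<close>

lemma character_cabs:
  assumes z: "z \<in> ACe" and k: "k \<in> characters"
  shows "k (cabs z) = cmod (gelfand z k)"
proof (rule antisym)
  have zA: "fst z \<in> Ae" "snd z \<in> Ae" using z by (simp_all add: ACe_iff)
  have comb: "cos t *\<^sub>R fst z + sin t *\<^sub>R snd z \<in> Ae" for t
    by (simp add: Ae_add Ae_scaleR zA)
  have eval: "h (cos t *\<^sub>R fst z + sin t *\<^sub>R snd z) = cos t * Re (gelfand z h) + sin t * Im (gelfand z h)"
    if "h \<in> characters" for h t
    using that by (simp add: gelfand_def character_add character_scaleR Ae_scaleR zA)
  have "continuous_on characters (\<lambda>h. cmod (gelfand z h))"
    by (intro continuous_intros continuous_on_gelfand)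
  from evaluation_surj[OF this] obtain g where
    g: "g \<in> Ae" "\<forall>h\<in>characters. h g = cmod (gelfand z h)"
    by blast
  have "cabs z \<le> g"
  proof (rule cabs_least)
    fix t
    have "cos t * Re c + sin t * Im c \<le> cmod c" for c
    proof -
      \<comment> \<open>Rotating \<open>c\<close> by - t turns the combination into a real part,
        which is at most the modulus.\<close>
      have "cos t * Re c + sin t * Im c = Re (cnj (cis t) * c)" by simp
      also have "\<dots> \<le> cmod (cnj (cis t) * c)" by (rule complex_Re_le_cmod)
      finally show ?thesis by (simp add: norm_mult)
    qed
    then show "cos t *\<^sub>R fst z + sin t *\<^sub>R snd z \<le> g"
      by (simp add: Ae_le_iff comb g eval)
  qed
  then show "k (cabs z) \<le> cmod (gelfand z k)"
    using character_mono[OF k cabs_in_Ae[OF z] g(1)] g(2) k by simp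
  \<comment> \<open>The pointwise maximum is attained at the argument of the transform;
    \<open>Arg2pi\<close> takes values inside the interval of angles used by
    \<open>cabs\<close>.\<close>
  define t where "t = Arg2pi (gelfand z k)"
  have t: "0 \<le> t" "t < 2 * pi"
    using Arg2pi[of "gelfand z k"] by (simp_all add: t_def)
  have polar: "cmod (gelfand z k) * cos t = Re (gelfand z k)" "cmod (gelfand z k) * sin t = Im (gelfand z k)"
    using Arg2pi_eq[of "gelfand z k"] unfolding t_def
    by (metis Re_rcis cis_conv_exp rcis_def, metis Im_rcis cis_conv_exp rcis_def)
  have "cmod (gelfand z k) = cmod (gelfand z k) * (cos t * cos t + sin t * sin t)"
    by simp
  also have "\<dots> = cos t * Re (gelfand z k) + sin t * Im (gelfand z k)"
    unfolding polar[symmetric] by (simp only: distrib_left mult_ac)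
  also have "\<dots> = k (cos t *\<^sub>R fst z + sin t *\<^sub>R snd z)"
    by (simp add: eval[OF k])
  also have "\<dots> \<le> k (cabs z)"
    using t by (intro character_mono[OF k comb cabs_in_Ae[OF z]] cabs_upper) auto
  finally show "cmod (gelfand z k) \<le> k (cabs z)" .
qed

lemma cnorm_eq_SUP:
  assumes z: "z \<in> ACe"
  shows "cnorm z = (SUP k\<in>characters. cmod (gelfand z k))"
proof (rule antisym)
  have k: "k (cabs z) = cmod (gelfand z k)" if "k \<in> characters" for k
    using character_cabs[OF z that] .
  have bdd: "bdd_above ((\<lambda>k. cmod (gelfand z k)) ` characters)"
    using character_le_norm[of _ "cabs z"] k by (intro bdd_aboveI2[of _ _ "norm (cabs z)"]) fastforce
  show "cnorm z \<le> (SUP k\<in>characters. cmod (gelfand z k))"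
    unfolding cnorm_def
  proof (rule Ae_norm_leI[OF cabs_in_Ae[OF z]])
    fix k' assume "k' \<in> characters"
    then show "\<bar>k' (cabs z)\<bar> \<le> (SUP k\<in>characters. cmod (gelfand z k))"
      using cSUP_upper[OF _ bdd] by (simp add: k)
  qed
  show "(SUP k\<in>characters. cmod (gelfand z k)) \<le> cnorm z"
    unfolding cnorm_def using character_le_norm[of _ "cabs z"] k
    by (intro cSUP_least characters_nonempty) fastforce
qed

text \<open>If c is a value of the transform at k, an inverse of z - c would lie in
  \<open>ACe\<close> by inverse closedness, and multiplicativity at k would give 0 = 1. If c is not
  a value, the reciprocal of the transform of z - c is continuous, and by surjectivity it is the
  transform of an inverse.\<close>

lemma cspectrum_eq_range:
  assumes z: "z \<in> ACe"
  shows "cspectrum z = gelfand z ` characters"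
proof (intro equalityI subsetI)
  fix c assume "c \<in> gelfand z ` characters"
  then obtain k where k: "k \<in> characters" "c = gelfand z k" by blast
  define b where "b = cminus z (cscale c cone)"
  have b: "b \<in> ACe"
    by (simp add: b_def ACe_cminus z ACe_cscale ACe_cone)
  have "gelfand b k = 0"
    using k by (simp add: b_def gelfand_cminus z ACe_cscale ACe_cone gelfand_cscale gelfand_cone)
  then have "cmult b w \<noteq> cone \<or> cmult w b \<noteq> cone" for w
    using ACe_inverse_closed[OF b, of w] gelfand_cmult[OF k(1) b, of w] gelfand_cone[OF k(1)] by auto
  then show "c \<in> cspectrum z"
    by (auto simp: cspectrum_def cinvertible_def b_def)
next
  fix c assume c: "c \<in> cspectrum z"
  show "c \<in> gelfand z ` characters"
  proof (rule ccontr)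
    assume not: "c \<notin> gelfand z ` characters"
    define b where "b = cminus z (cscale c cone)"
    have b: "b \<in> ACe"
      by (simp add: b_def ACe_cminus z ACe_cscale ACe_cone)
    have gb: "gelfand b k = gelfand z k - c" if "k \<in> characters" for k
      using that by (simp add: b_def gelfand_cminus z ACe_cscale ACe_cone gelfand_cscale gelfand_cone)
    have "continuous_on characters (\<lambda>k. inverse (gelfand z k - c))"
      using not by (intro continuous_intros continuous_on_gelfand) auto
    from gelfand_surj[OF this] obtain w where
      w: "w \<in> ACe" "\<forall>k\<in>characters. gelfand w k = inverse (gelfand z k - c)"
      by blast
    have prod: "gelfand b k * gelfand w k = 1" "gelfand w k * gelfand b k = 1"
      if k: "k \<in> characters" for k
    proof -
      have "gelfand z k - c \<noteq> 0"
        using not k by auto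
      then show "gelfand b k * gelfand w k = 1" "gelfand w k * gelfand b k = 1"
        using w(2) k by (simp_all add: gb)
    qed
    have "cmult b w = cone" "cmult w b = cone"
      by (rule gelfand_inj; simp add: ACe_cmult b w(1) ACe_cone gelfand_cmult gelfand_cone prod)+
    then show False
      using c unfolding cspectrum_def cinvertible_def b_def by blast
  qed
qed

lemma cspectral_radius_eq: "z \<in> ACe \<Longrightarrow> cspectral_radius z = cnorm z" for z :: "'a \<times> 'a"
  by (simp add: cspectral_radius_def cspectrum_eq_range cnorm_eq_SUP image_image)

end

theorem mainTheorem13:
  fixes dummy :: "'a::{real_normed_algebra_1, banach, lattice_ab_group_add}"
  assumes vl: "\<And>(x::'a) y (c::real). x \<le> y \<Longrightarrow> 0 \<le> c \<Longrightarrow> c *\<^sub>R x \<le> c *\<^sub>R y"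
    and lattice_norm: "\<And>(x::'a) y. lat_abs x \<le> lat_abs y \<Longrightarrow> norm x \<le> norm y"
    and pos_mult: "\<And>(x::'a) y. 0 \<le> x \<Longrightarrow> 0 \<le> y \<Longrightarrow> 0 \<le> x * y"
  shows
    "(ACe :: ('a \<times> 'a) set) = {(x, y). x \<in> Ae \<and> y \<in> Ae}
     \<and> (\<forall>z \<in> (ACe :: ('a \<times> 'a) set). cnorm z = enorm z \<and> enorm z = cspectral_radius z)
     \<and> (\<exists>(T :: ('a \<Rightarrow> real) topology) (\<Phi> :: 'a \<times> 'a \<Rightarrow> ('a \<Rightarrow> real) \<Rightarrow> complex).
          compact_space T \<and> Hausdorff_space T
          \<and> (\<forall>z\<in>ACe. continuous_map T euclidean (\<Phi> z))
          \<and> (\<forall>f. continuous_map T euclidean f \<longrightarrow> (\<exists>z\<in>ACe. \<forall>k\<in>topspace T. \<Phi> z k = f k))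
          \<and> (\<forall>z\<in>ACe. \<forall>w\<in>ACe. (\<forall>k\<in>topspace T. \<Phi> z k = \<Phi> w k) \<longrightarrow> z = w)
          \<and> (\<forall>z\<in>ACe. \<forall>w\<in>ACe. \<forall>k\<in>topspace T. \<Phi> (cadd z w) k = \<Phi> z k + \<Phi> w k)
          \<and> (\<forall>c. \<forall>z\<in>ACe. \<forall>k\<in>topspace T. \<Phi> (cscale c z) k = c * \<Phi> z k)
          \<and> (\<forall>z\<in>ACe. \<forall>w\<in>ACe. \<forall>k\<in>topspace T. \<Phi> (cmult z w) k = \<Phi> z k * \<Phi> w k)
          \<and> (\<forall>k\<in>topspace T. \<Phi> cone k = 1)
          \<and> (\<forall>z\<in>ACe. \<forall>k\<in>topspace T. \<Phi> (cabs z, 0) k = complex_of_real (cmod (\<Phi> z k)))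
          \<and> (\<forall>x\<in>Ae. \<forall>k\<in>topspace T. \<Phi> (x, 0) k \<in> \<real>)
          \<and> (\<forall>x\<in>Ae. 0 \<le> x \<longleftrightarrow> (\<forall>k\<in>topspace T. 0 \<le> Re (\<Phi> (x, 0) k)))
          \<and> (\<forall>z\<in>ACe. cnorm z = (SUP k\<in>topspace T. cmod (\<Phi> z k))))
     \<and> (\<forall>x\<in>(Ae :: 'a set). norm x = Inf {l::real. l > 0 \<and> lat_abs x \<le> l *\<^sub>R 1})
     \<and> (\<forall>z :: 'a \<times> 'a. \<exists>!p. fst p \<in> ACe \<and> snd p \<in> cdisj ACe \<and> z = cadd (fst p) (snd p))
     \<and> (cone :: 'a \<times> 'a) \<in> ACe
     \<and> (\<forall>z\<in>(ACe :: ('a \<times> 'a) set). \<forall>w\<in>ACe. cadd z w \<in> ACe \<and> cmult z w \<in> ACe)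
     \<and> (\<forall>c. \<forall>z\<in>(ACe :: ('a \<times> 'a) set). cscale c z \<in> ACe)
     \<and> (\<forall>b\<in>(ACe :: ('a \<times> 'a) set). \<forall>w. cmult b w = cone \<and> cmult w b = cone \<longrightarrow> w \<in> ACe)"
proof -
  interpret banach_lattice_algebra "TYPE('a)"
    by unfold_locales (fact vl lattice_norm pos_mult)+
  \<comment> \<open>The compact space K is the set of characters with the topology of pointwise
    convergence.\<close>
  let ?T = "top_of_set characters :: ('a \<Rightarrow> real) topology"
  have decomp: "\<exists>!p. fst p \<in> ACe \<and> snd p \<in> cdisj ACe \<and> z = cadd (fst p) (snd p)" for z :: "'a \<times> 'a"
  proof -
    obtain u v where uv: "u \<in> ACe" "v \<in> cdisj ACe" "z = cadd u v"
      by (rule complex_decomposition)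
    show ?thesis
    proof (rule ex1I[of _ "(u, v)"])
      fix p :: "('a \<times> 'a) \<times> 'a \<times> 'a"
      assume p: "fst p \<in> ACe \<and> snd p \<in> cdisj ACe \<and> z = cadd (fst p) (snd p)"
      then show "p = (u, v)"
        using complex_decomposition_unique[of "fst p" "snd p" u v] uv by (simp add: prod_eq_iff)
    qed (use uv in simp)
  qed
  have rep: "\<exists>(T :: ('a \<Rightarrow> real) topology) (\<Phi> :: 'a \<times> 'a \<Rightarrow> ('a \<Rightarrow> real) \<Rightarrow> complex).
          compact_space T \<and> Hausdorff_space T
          \<and> (\<forall>z\<in>ACe. continuous_map T euclidean (\<Phi> z))
          \<and> (\<forall>f. continuous_map T euclidean f \<longrightarrow> (\<exists>z\<in>ACe. \<forall>k\<in>topspace T. \<Phi> z k = f k))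
          \<and> (\<forall>z\<in>ACe. \<forall>w\<in>ACe. (\<forall>k\<in>topspace T. \<Phi> z k = \<Phi> w k) \<longrightarrow> z = w)
          \<and> (\<forall>z\<in>ACe. \<forall>w\<in>ACe. \<forall>k\<in>topspace T. \<Phi> (cadd z w) k = \<Phi> z k + \<Phi> w k)
          \<and> (\<forall>c. \<forall>z\<in>ACe. \<forall>k\<in>topspace T. \<Phi> (cscale c z) k = c * \<Phi> z k)
          \<and> (\<forall>z\<in>ACe. \<forall>w\<in>ACe. \<forall>k\<in>topspace T. \<Phi> (cmult z w) k = \<Phi> z k * \<Phi> w k)
          \<and> (\<forall>k\<in>topspace T. \<Phi> cone k = 1)
          \<and> (\<forall>z\<in>ACe. \<forall>k\<in>topspace T. \<Phi> (cabs z, 0) k = complex_of_real (cmod (\<Phi> z k)))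
          \<and> (\<forall>x\<in>Ae. \<forall>k\<in>topspace T. \<Phi> (x, 0) k \<in> \<real>)
          \<and> (\<forall>x\<in>Ae. 0 \<le> x \<longleftrightarrow> (\<forall>k\<in>topspace T. 0 \<le> Re (\<Phi> (x, 0) k)))
          \<and> (\<forall>z\<in>ACe. cnorm z = (SUP k\<in>topspace T. cmod (\<Phi> z k)))"
  proof (rule exI[of _ ?T], rule exI[of _ gelfand], intro conjI)
    show "compact_space ?T"
      by (simp add: compact_space_subtopology compact_characters)
    have "Hausdorff_space (product_topology (\<lambda>_. euclideanreal) (UNIV :: 'a set))"
      by (simp add: Hausdorff_space_product_topology)
    then show "Hausdorff_space ?T"
      by (simp add: euclidean_product_topology Hausdorff_space_subtopology)
    show "\<forall>f. continuous_map ?T euclidean f \<longrightarrow> (\<exists>z\<in>ACe. \<forall>k\<in>topspace ?T. gelfand z k = f k)"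
      by (auto intro!: gelfand_surj)
    show "\<forall>z\<in>ACe. \<forall>w\<in>ACe. (\<forall>k\<in>topspace ?T. gelfand z k = gelfand w k) \<longrightarrow> z = w"
      using gelfand_inj by simp
  qed (auto simp: continuous_on_gelfand gelfand_cadd gelfand_cscale gelfand_cmult gelfand_cone
      gelfand_real character_cabs Ae_nonneg_iff cnorm_eq_SUP)
  show ?thesis
  proof (intro conjI)
    show "ACe = {(x :: 'a, y). x \<in> Ae \<and> y \<in> Ae}"
      by (auto simp: ACe_iff)
    show "\<forall>z \<in> (ACe :: ('a \<times> 'a) set). cnorm z = enorm z \<and> enorm z = cspectral_radius z"
      by (simp add: cspectral_radius_eq cnorm_eq_enorm)
    show "\<forall>x\<in>(Ae :: 'a set). norm x = Inf {l::real. l > 0 \<and> lat_abs x \<le> l *\<^sub>R 1}"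
      by (intro ballI Ae_norm_eq_Inf)
    show "\<forall>b\<in>(ACe :: ('a \<times> 'a) set). \<forall>w. cmult b w = cone \<and> cmult w b = cone \<longrightarrow> w \<in> ACe"
      by (blast intro: ACe_inverse_closed)
  qed (use rep decomp in \<open>simp_all add: ACe_cone ACe_cadd ACe_cmult ACe_cscale\<close>)
qed

end
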